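(* Let $n,m\ge 2$ be integers. For any $q\in\mathbb{C}$ with $|q|<1$, one has an isomorphism of $C^*$-algebras $\mathcal{E}_{n,m}^q\simeq\mathcal{E}_{n,m}^0$.
   Context: For $q\in\mathbb{C}$, $|q|\le 1$, $\mathcal{E}_{n,m}^q$ denotes the universal unital $C^*$-algebra generated by elements $s_1,\dots,s_n,t_1,\dots,t_m$ subject to the relations $s_i^*s_j=\delta_{ij}\mathbf 1$, $t_r^*t_l=\delta_{rl}\mathbf 1$, $s_j^*t_r=q\,t_rs_j^*$ for all $i,j\in\{1,\dots,n\}$, $r,l\in\{1,\dots,m\}$. In particular $\mathcal{E}_{n,m}^0=\mathcal{O}_{n+m}^{(0)}$ is the Cuntz–Toeplitz algebra, i.e. the universal unital $C^*$-algebra generated by $n+m$ isometries with pairwise orthogonal ranges. *)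

theory Defs
  imports Complex_Main "HOL-Library.Poly_Mapping" "HOL-Algebra.QuotRing"
begin

section \<open>Unital C*-algebras\<close>

record 'a cstar_algebra = "'a ring" +
  scale :: "complex \<Rightarrow> 'a \<Rightarrow> 'a"
  adj :: "'a \<Rightarrow> 'a"
  nrm :: "'a \<Rightarrow> real"

text \<open>The ring axioms of HOL-Algebra include the unit but not \<open>1 \<noteq> 0\<close>, so the zero algebra is
  admitted.\<close>

locale unital_cstar_algebra = ring A for A :: "('a, 'e) cstar_algebra_scheme" (structure) +
  assumes scale_closed [simp]: "x \<in> carrier A \<Longrightarrow> scale A c x \<in> carrier A"
    and scale_add: "\<lbrakk>x \<in> carrier A; y \<in> carrier A\<rbrakk> \<Longrightarrow>
      scale A c (x \<oplus> y) = scale A c x \<oplus> scale A c y"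
    and add_scale: "x \<in> carrier A \<Longrightarrow> scale A (c + d) x = scale A c x \<oplus> scale A d x"
    and scale_scale: "x \<in> carrier A \<Longrightarrow> scale A c (scale A d x) = scale A (c * d) x"
    and scale_1: "x \<in> carrier A \<Longrightarrow> scale A 1 x = x"
    and scale_mult_left: "\<lbrakk>x \<in> carrier A; y \<in> carrier A\<rbrakk> \<Longrightarrow>
      scale A c x \<otimes> y = scale A c (x \<otimes> y)"
    and scale_mult_right: "\<lbrakk>x \<in> carrier A; y \<in> carrier A\<rbrakk> \<Longrightarrow>
      x \<otimes> scale A c y = scale A c (x \<otimes> y)"
    and adj_closed [simp]: "x \<in> carrier A \<Longrightarrow> adj A x \<in> carrier A"
    and adj_adj: "x \<in> carrier A \<Longrightarrow> adj A (adj A x) = x"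
    and adj_add: "\<lbrakk>x \<in> carrier A; y \<in> carrier A\<rbrakk> \<Longrightarrow> adj A (x \<oplus> y) = adj A x \<oplus> adj A y"
    and adj_scale: "x \<in> carrier A \<Longrightarrow> adj A (scale A c x) = scale A (cnj c) (adj A x)"
    and adj_mult: "\<lbrakk>x \<in> carrier A; y \<in> carrier A\<rbrakk> \<Longrightarrow> adj A (x \<otimes> y) = adj A y \<otimes> adj A x"
    and nrm_eq_0: "x \<in> carrier A \<Longrightarrow> nrm A x = 0 \<longleftrightarrow> x = \<zero>"
    and nrm_triangle: "\<lbrakk>x \<in> carrier A; y \<in> carrier A\<rbrakk> \<Longrightarrow> nrm A (x \<oplus> y) \<le> nrm A x + nrm A y"
    and nrm_scale: "x \<in> carrier A \<Longrightarrow> nrm A (scale A c x) = cmod c * nrm A x"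
    and nrm_mult: "\<lbrakk>x \<in> carrier A; y \<in> carrier A\<rbrakk> \<Longrightarrow> nrm A (x \<otimes> y) \<le> nrm A x * nrm A y"
    and nrm_adj_mult: "x \<in> carrier A \<Longrightarrow> nrm A (adj A x \<otimes> x) = (nrm A x)\<^sup>2"
    and complete: "\<lbrakk>\<And>i. X i \<in> carrier A;
        \<And>e. e > 0 \<Longrightarrow> \<exists>K. \<forall>i\<ge>K. \<forall>j\<ge>K. nrm A (X i \<ominus> X j) < e\<rbrakk> \<Longrightarrow>
      \<exists>x\<in>carrier A. (\<lambda>i. nrm A (X i \<ominus> x)) \<longlonglongrightarrow> 0"

text \<open>Unital *-homomorphisms and *-isomorphisms; both are automatically contractive, resp.
  isometric.\<close>

definition cstar_hom ::
  "('a, 'e) cstar_algebra_scheme \<Rightarrow> ('b, 'f) cstar_algebra_scheme \<Rightarrow> ('a \<Rightarrow> 'b) set" where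
  "cstar_hom A B = {h \<in> ring_hom A B.
     (\<forall>c. \<forall>x\<in>carrier A. h (scale A c x) = scale B c (h x)) \<and>
     (\<forall>x\<in>carrier A. h (adj A x) = adj B (h x))}"

definition cstar_isomorphic ::
  "('a, 'e) cstar_algebra_scheme \<Rightarrow> ('b, 'f) cstar_algebra_scheme \<Rightarrow> bool" where
  "cstar_isomorphic A B \<longleftrightarrow> (\<exists>h\<in>cstar_hom A B. bij_betw h (carrier A) (carrier B))"


section \<open>The free unital *-algebra\<close>

datatype 'g letter = Gen 'g | Adj 'g

primrec adj_letter :: "'g letter \<Rightarrow> 'g letter" where
  "adj_letter (Gen g) = Adj g"
| "adj_letter (Adj g) = Gen g"

text \<open>Words form a monoid under concatenation. Written additively, this turns the finitely supported
  functions from words to \<open>\<complex>\<close> into the (noncommutative) monoid algebra of \<^theory>\<open>HOL-Library.Poly_Mapping\<close>.\<close>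

instantiation list :: (type) monoid_add
begin
definition zero_list :: "'a list" where "zero_list = []"
definition plus_list :: "'a list \<Rightarrow> 'a list \<Rightarrow> 'a list" where "plus_list = (@)"
instance by standard (simp_all add: zero_list_def plus_list_def)
end

type_synonym 'g star_poly = "'g letter list \<Rightarrow>\<^sub>0 complex"

definition scalar :: "complex \<Rightarrow> 'g star_poly" where
  "scalar c = Poly_Mapping.single [] c"

definition gen :: "'g \<Rightarrow> 'g star_poly" where
  "gen g = Poly_Mapping.single [Gen g] 1"

definition star :: "'g star_poly \<Rightarrow> 'g star_poly" where
  "star f = (\<Sum>w\<in>Poly_Mapping.keys f.
     Poly_Mapping.single (rev (map adj_letter w)) (cnj (Poly_Mapping.lookup f w)))"

definition star_polys :: "'g set \<Rightarrow> 'g star_poly set" where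
  "star_polys G = {f. \<forall>w\<in>Poly_Mapping.keys f. set w \<subseteq> Gen ` G \<union> Adj ` G}"


section \<open>Universal unital C*-algebras given by generators and relations\<close>

text \<open>The functions \<open>f \<mapsto> \<parallel>\<pi> f\<parallel>\<close>, where \<open>\<pi>\<close> is a unital *-homomorphism from the free *-algebra to a
  C*-algebra in which the relations hold, are exactly the C*-seminorms vanishing on the relators.
  Only their values on \<^term>\<open>star_polys G\<close> matter.\<close>

definition cstar_seminorm :: "'g set \<Rightarrow> ('g star_poly \<Rightarrow> real) \<Rightarrow> bool" where
  "cstar_seminorm G p \<longleftrightarrow> (\<forall>f\<in>star_polys G.
     (\<forall>c. p (scalar c * f) = cmod c * p f) \<and>
     p (star f * f) = (p f)\<^sup>2 \<and>
     (\<forall>g\<in>star_polys G. p (f + g) \<le> p f + p g \<and> p (f * g) \<le> p f * p g))"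

definition univ_seminorm :: "'g set \<Rightarrow> 'g star_poly set \<Rightarrow> 'g star_poly \<Rightarrow> real" where
  "univ_seminorm G R f = Sup {p f | p. cstar_seminorm G p \<and> (\<forall>r\<in>R. p r = 0)}"

definition cauchy_ring :: "'g set \<Rightarrow> 'g star_poly set \<Rightarrow> (nat \<Rightarrow> 'g star_poly) ring" where
  "cauchy_ring G R =
     \<lparr>carrier = {X. (\<forall>i. X i \<in> star_polys G) \<and>
        (\<forall>e>0. \<exists>K. \<forall>i\<ge>K. \<forall>j\<ge>K. univ_seminorm G R (X i - X j) < e)},
      mult = (\<lambda>X Y i. X i * Y i), one = (\<lambda>i. 1), zero = (\<lambda>i. 0), add = (\<lambda>X Y i. X i + Y i)\<rparr>"

definition null_ideal :: "'g set \<Rightarrow> 'g star_poly set \<Rightarrow> (nat \<Rightarrow> 'g star_poly) set" where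
  "null_ideal G R =
     {X \<in> carrier (cauchy_ring G R). (\<lambda>i. univ_seminorm G R (X i)) \<longlonglongrightarrow> 0}"

text \<open>The separated completion of the free *-algebra with respect to \<^const>\<open>univ_seminorm\<close>. As usual, the
  universal C*-algebra exists only if the relations force a bound on the norms of the generators.\<close>

definition univ_cstar ::
  "'g set \<Rightarrow> 'g star_poly set \<Rightarrow> (nat \<Rightarrow> 'g star_poly) set cstar_algebra" where
  "univ_cstar G R = ring.extend (cauchy_ring G R Quot null_ideal G R)
     \<lparr>scale = (\<lambda>c A. \<Union>X\<in>A. null_ideal G R +>\<^bsub>cauchy_ring G R\<^esub> (\<lambda>i. scalar c * X i)),
      adj = (\<lambda>A. \<Union>X\<in>A. null_ideal G R +>\<^bsub>cauchy_ring G R\<^esub> (\<lambda>i. star (X i))),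
      nrm = (\<lambda>A. THE r. \<forall>X\<in>A. (\<lambda>i. univ_seminorm G R (X i)) \<longlonglongrightarrow> r)\<rparr>"

definition univ_gen :: "'g set \<Rightarrow> 'g star_poly set \<Rightarrow> 'g \<Rightarrow> (nat \<Rightarrow> 'g star_poly) set" where
  "univ_gen G R g = null_ideal G R +>\<^bsub>cauchy_ring G R\<^esub> (\<lambda>i. gen g)"


section \<open>The algebras \<open>\<E>\<^sup>q\<^bsub>n,m\<^esub>\<close>\<close>

datatype E_gen = GenS nat | GenT nat

definition E_gens :: "nat \<Rightarrow> nat \<Rightarrow> E_gen set" where
  "E_gens n m = GenS ` {1..n} \<union> GenT ` {1..m}"

definition E_relators :: "nat \<Rightarrow> nat \<Rightarrow> complex \<Rightarrow> E_gen star_poly set" where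
  "E_relators n m q =
     {star (gen (GenS i)) * gen (GenS j) - of_bool (i = j) | i j. i \<in> {1..n} \<and> j \<in> {1..n}} \<union>
     {star (gen (GenT r)) * gen (GenT l) - of_bool (r = l) | r l. r \<in> {1..m} \<and> l \<in> {1..m}} \<union>
     {star (gen (GenS j)) * gen (GenT r) - scalar q * gen (GenT r) * star (gen (GenS j)) | j r.
        j \<in> {1..n} \<and> r \<in> {1..m}}"

definition E_cstar ::
  "nat \<Rightarrow> nat \<Rightarrow> complex \<Rightarrow> (nat \<Rightarrow> E_gen star_poly) set cstar_algebra" where
  "E_cstar n m q = univ_cstar (E_gens n m) (E_relators n m q)"


section \<open>Existence and universal property of \<open>\<E>\<^sup>q\<^bsub>n,m\<^esub>\<close>\<close>

text \<open>The rest of this theory shows that \<^const>\<open>E_cstar\<close> is indeed the universal unital C*-algebra for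
  its presentation: it is a unital C*-algebra, it is generated by elements satisfying the relations, and it
  maps to every unital C*-algebra (over any type) that contains such elements.\<close>

text \<open>The generators of \<^term>\<open>E_cstar n m q\<close>, and the relations for elements of an arbitrary C*-algebra.\<close>

definition E_s where "E_s n m q i = univ_gen (E_gens n m) (E_relators n m q) (GenS i)"
definition E_t where "E_t n m q r = univ_gen (E_gens n m) (E_relators n m q) (GenT r)"

definition E_family ::
  "nat \<Rightarrow> nat \<Rightarrow> complex \<Rightarrow> ('a, 'e) cstar_algebra_scheme \<Rightarrow> (nat \<Rightarrow> 'a) \<Rightarrow> (nat \<Rightarrow> 'a) \<Rightarrow> bool" where
  "E_family n m q B s t \<longleftrightarrow>
     (\<forall>i\<in>{1..n}. s i \<in> carrier B) \<and> (\<forall>r\<in>{1..m}. t r \<in> carrier B) \<and>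
     (\<forall>i\<in>{1..n}. \<forall>j\<in>{1..n}. adj B (s i) \<otimes>\<^bsub>B\<^esub> s j = (if i = j then \<one>\<^bsub>B\<^esub> else \<zero>\<^bsub>B\<^esub>)) \<and>
     (\<forall>r\<in>{1..m}. \<forall>l\<in>{1..m}. adj B (t r) \<otimes>\<^bsub>B\<^esub> t l = (if r = l then \<one>\<^bsub>B\<^esub> else \<zero>\<^bsub>B\<^esub>)) \<and>
     (\<forall>j\<in>{1..n}. \<forall>r\<in>{1..m}. adj B (s j) \<otimes>\<^bsub>B\<^esub> t r = scale B q (t r \<otimes>\<^bsub>B\<^esub> adj B (s j)))"


subsection \<open>Calculations in the free *-algebra\<close>

lemma adj_letter_adj_letter [simp]: "adj_letter (adj_letter l) = l"
  by (cases l) auto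

lemma adj_word_swap: "rev (map adj_letter w) = v \<longleftrightarrow> w = rev (map adj_letter v)"
  by (auto simp: rev_map o_def)

lemma lookup_star: "Poly_Mapping.lookup (star f) w = cnj (Poly_Mapping.lookup f (rev (map adj_letter w)))"
proof -
  have "Poly_Mapping.lookup (star f) w =
      (\<Sum>v\<in>Poly_Mapping.keys f. if v = rev (map adj_letter w) then cnj (Poly_Mapping.lookup f v) else 0)"
    unfolding star_def lookup_sum
    by (intro sum.cong refl) (auto simp: lookup_single when_def adj_word_swap rev_map o_def)
  also have "\<dots> = cnj (Poly_Mapping.lookup f (rev (map adj_letter w)))"
    by (simp add: sum.delta' in_keys_iff)
  finally show ?thesis .
qed

lemma star_add: "star (f + g) = star f + star g"
  by (rule poly_mapping_eqI) (simp add: lookup_star lookup_add)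

lemma star_star: "star (star f) = f"
  by (rule poly_mapping_eqI) (simp add: lookup_star rev_map o_def)

lemma star_0 [simp]: "star 0 = 0"
  by (rule poly_mapping_eqI) (simp add: lookup_star)

lemma star_minus: "star (f - g) = star f - star g"
  by (rule poly_mapping_eqI) (simp add: lookup_star lookup_minus)

lemma star_single: "star (Poly_Mapping.single w c) = Poly_Mapping.single (rev (map adj_letter w)) (cnj c)"
  by (rule poly_mapping_eqI) (auto simp: lookup_star lookup_single when_def adj_word_swap rev_map o_def)

lemma star_polysI: "(\<And>w. w \<in> Poly_Mapping.keys f \<Longrightarrow> set w \<subseteq> Gen ` G \<union> Adj ` G) \<Longrightarrow> f \<in> star_polys G"
  by (auto simp: star_polys_def)

lemma star_polysD: "f \<in> star_polys G \<Longrightarrow> w \<in> Poly_Mapping.keys f \<Longrightarrow> set w \<subseteq> Gen ` G \<union> Adj ` G"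
  by (auto simp: star_polys_def)

lemma star_polys_add [simp]: "f \<in> star_polys G \<Longrightarrow> g \<in> star_polys G \<Longrightarrow> f + g \<in> star_polys G"
  using keys_add[of f g] by (blast intro: star_polysI dest: star_polysD)

lemma star_polys_0 [simp]: "0 \<in> star_polys G"
  by (simp add: star_polys_def)

lemma star_polys_single: "set w \<subseteq> Gen ` G \<union> Adj ` G \<Longrightarrow> Poly_Mapping.single w c \<in> star_polys G"
  by (auto simp: star_polys_def split: if_splits)

lemma star_polys_uminus [simp]: "f \<in> star_polys G \<Longrightarrow> - f \<in> star_polys G"
  by (auto simp: star_polys_def in_keys_iff)

lemma star_polys_diff [simp]: "f \<in> star_polys G \<Longrightarrow> g \<in> star_polys G \<Longrightarrow> f - g \<in> star_polys G"
  using star_polys_add[of f G "- g"] by simp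

lemma star_polys_mult [simp]: "f \<in> star_polys G \<Longrightarrow> g \<in> star_polys G \<Longrightarrow> f * g \<in> star_polys G"
proof (rule star_polysI)
  fix w assume f: "f \<in> star_polys G" and g: "g \<in> star_polys G" and "w \<in> Poly_Mapping.keys (f * g)"
  then obtain u v where "w = u + v" "u \<in> Poly_Mapping.keys f" "v \<in> Poly_Mapping.keys g"
    using keys_mult[of f g] by blast
  then show "set w \<subseteq> Gen ` G \<union> Adj ` G"
    using star_polysD[OF f, of u] star_polysD[OF g, of v] by (auto simp: plus_list_def)
qed

lemma scalar_in [simp]: "scalar c \<in> star_polys G"
  unfolding scalar_def by (rule star_polys_single) simp

lemma scalar_1: "scalar 1 = 1"
  unfolding scalar_def by (metis single_one zero_list_def)

lemma one_in [simp]: "1 \<in> star_polys G"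
  by (metis scalar_in scalar_1)

lemma gen_in [simp]: "g \<in> G \<Longrightarrow> gen g \<in> star_polys G"
  unfolding gen_def by (rule star_polys_single) simp

lemma star_in [simp]: "f \<in> star_polys G \<Longrightarrow> star f \<in> star_polys G"
proof (rule star_polysI)
  fix w assume f: "f \<in> star_polys G" and "w \<in> Poly_Mapping.keys (star f)"
  then have "rev (map adj_letter w) \<in> Poly_Mapping.keys f"
    by (simp add: in_keys_iff lookup_star)
  from star_polysD[OF f this] have *: "adj_letter ` set w \<subseteq> Gen ` G \<union> Adj ` G"
    by simp
  show "set w \<subseteq> Gen ` G \<union> Adj ` G"
  proof
    fix l assume "l \<in> set w"
    with * have "adj_letter l \<in> Gen ` G \<union> Adj ` G" by blast
    then show "l \<in> Gen ` G \<union> Adj ` G" by (cases l) auto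
  qed
qed

lemma poly_sum_singles:
  "f = (\<Sum>w\<in>Poly_Mapping.keys f. Poly_Mapping.single w (Poly_Mapping.lookup f w))"
  by (rule poly_mapping_eqI)
    (simp add: lookup_sum lookup_single when_def sum.delta' in_keys_iff)

lemma star_polys_induct [consumes 1, case_names zero single add]:
  assumes "f \<in> star_polys G"
    and z: "P 0"
    and s: "\<And>w c. set w \<subseteq> Gen ` G \<union> Adj ` G \<Longrightarrow> P (Poly_Mapping.single w c)"
    and a: "\<And>f g. \<lbrakk>f \<in> star_polys G; g \<in> star_polys G; P f; P g\<rbrakk> \<Longrightarrow> P (f + g)"
  shows "P f"
proof -
  have "F \<subseteq> Poly_Mapping.keys f \<Longrightarrow>
    (\<Sum>w\<in>F. Poly_Mapping.single w (Poly_Mapping.lookup f w)) \<in> star_polys G \<and>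
    P (\<Sum>w\<in>F. Poly_Mapping.single w (Poly_Mapping.lookup f w))" if "finite F" for F
    using that
  proof induction
    case empty
    then show ?case using z by simp
  next
    case (insert w F)
    have w: "set w \<subseteq> Gen ` G \<union> Adj ` G" using insert.prems star_polysD[OF assms(1)] by blast
    show ?case
      using insert s[OF w] star_polys_single[OF w] by (auto intro!: a)
  qed
  from this[OF finite_keys subset_refl] show ?thesis
    using poly_sum_singles[of f] by simp
qed

lemma star_polys_UNIV: "f \<in> star_polys UNIV"
proof (rule star_polysI)
  fix w :: "'a letter list"
  have "l \<in> range Gen \<union> range Adj" for l :: "'a letter" by (cases l) auto
  then show "set w \<subseteq> range Gen \<union> range Adj" by blast
qed

lemma mult_single_append: "Poly_Mapping.single v a * Poly_Mapping.single w b =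
   Poly_Mapping.single (v @ w) (a * b :: complex)"
  by (simp add: mult_single plus_list_def)

lemma star_mult: "star (f * g) = star g * star f"
proof (induction rule: star_polys_induct[OF star_polys_UNIV[of f]])
  case (2 v a)
  show ?case
    by (induction rule: star_polys_induct[OF star_polys_UNIV[of g]])
      (auto simp: mult_single_append star_single algebra_simps star_add)
qed (auto simp: algebra_simps star_add)

lemma scalar_commute: "scalar c * f = f * scalar c"
  by (induction rule: star_polys_induct[OF star_polys_UNIV[of f]])
    (auto simp: scalar_def mult_single_append algebra_simps)

lemma scalar_mult: "scalar c * scalar d = scalar (c * d)"
  by (simp add: scalar_def mult_single_append)

lemma scalar_add: "scalar (c + d) = scalar c + scalar d"
  by (simp add: scalar_def single_add)

lemma scalar_uminus: "scalar (- c) = - scalar c"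
  by (simp add: scalar_def single_uminus)

lemma star_scalar: "star (scalar c) = scalar (cnj c)"
  by (simp add: scalar_def star_single)

lemma star_1 [simp]: "star 1 = 1"
  by (metis star_scalar scalar_1 complex_cnj_one)

lemma scalar_0: "scalar 0 = 0"
  by (simp add: scalar_def)


lemma cstar_seminormD:
  assumes "cstar_seminorm G p" "f \<in> star_polys G"
  shows "p (scalar c * f) = cmod c * p f" "p (star f * f) = (p f)\<^sup>2"
    "g \<in> star_polys G \<Longrightarrow> p (f + g) \<le> p f + p g" "g \<in> star_polys G \<Longrightarrow> p (f * g) \<le> p f * p g"
  using assms unfolding cstar_seminorm_def by blast+

lemma cstar_seminorm_nonneg:
  assumes p: "cstar_seminorm G p" and f: "f \<in> star_polys G" shows "0 \<le> p f"
proof -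
  have "f + scalar (-1) * f = scalar 0 * f"
    by (simp add: scalar_uminus scalar_1 scalar_0)
  then show ?thesis
    using cstar_seminormD(3)[OF p f, of "scalar (-1) * f"] cstar_seminormD(1)[OF p f, of "-1"]
      cstar_seminormD(1)[OF p f, of 0] f by simp
qed

lemma cstar_seminorm_star_le:
  assumes p: "cstar_seminorm G p" and f: "f \<in> star_polys G" shows "p f \<le> p (star f)"
proof -
  have "(p f)\<^sup>2 \<le> p (star f) * p f"
    using cstar_seminormD(2)[OF p f] cstar_seminormD(4)[OF p star_in[OF f] f] by simp
  then show ?thesis
    using cstar_seminorm_nonneg[OF p f] cstar_seminorm_nonneg[OF p star_in[OF f]]
    by (cases "p f = 0") (auto simp: power2_eq_square)
qed

subsection \<open>Limits and evaluation of *-polynomials in C*-algebras\<close>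

lemma null_comparison:
  fixes f g :: "nat \<Rightarrow> real"
  assumes "\<And>i. \<bar>f i\<bar> \<le> g i" "g \<longlonglongrightarrow> 0" shows "f \<longlonglongrightarrow> 0"
proof (rule tendsto_0_le[OF assms(2), where K = 1])
  show "\<forall>\<^sub>F i in sequentially. norm (f i) \<le> norm (g i) * 1"
    using assms(1) by (intro always_eventually) (metis abs_ge_self mult.right_neutral order_trans real_norm_def)
qed

lemma lim_le:
  fixes f g :: "nat \<Rightarrow> real"
  assumes "f \<longlonglongrightarrow> a" "g \<longlonglongrightarrow> b" "\<And>i. i \<ge> K \<Longrightarrow> f i \<le> g i" shows "a \<le> b"
  using assms by (intro LIMSEQ_le) auto

context unital_cstar_algebra
begin

lemma scale_zero_right [simp]: "scale A c \<zero> = \<zero>"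
  using scale_add[of \<zero> \<zero> c] by (metis add.r_cancel_one' l_zero scale_closed zero_closed)

lemma scale_0 [simp]: assumes x: "x \<in> carrier A" shows "scale A 0 x = \<zero>"
  using add_scale[OF x, of 0 0] x by (metis add.r_cancel_one' add_0 scale_closed)

lemma scale_uminus: assumes x: "x \<in> carrier A" shows "scale A (-1) x = \<ominus> x"
proof -
  have "scale A (-1) x \<oplus> x = \<zero>"
    using add_scale[OF x, of "-1" 1] x by (simp add: scale_1)
  then show ?thesis using x by (metis minus_equality scale_closed)
qed

lemma adj_zero [simp]: "adj A \<zero> = \<zero>"
  using adj_add[of \<zero> \<zero>] by (metis add.r_cancel_one' l_zero adj_closed zero_closed)

lemma adj_one [simp]: "adj A \<one> = \<one>"
  using adj_mult[of "adj A \<one>" \<one>] by (simp add: adj_adj)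

lemma adj_minus: "x \<in> carrier A \<Longrightarrow> y \<in> carrier A \<Longrightarrow> adj A (x \<ominus> y) = adj A x \<ominus> adj A y"
  unfolding a_minus_def by (simp add: adj_add adj_scale flip: scale_uminus)

lemma scale_minus: "x \<in> carrier A \<Longrightarrow> y \<in> carrier A \<Longrightarrow> scale A c (x \<ominus> y) = scale A c x \<ominus> scale A c y"
  unfolding a_minus_def by (simp add: scale_add scale_scale mult.commute flip: scale_uminus)

lemma nrm_zero [simp]: "nrm A \<zero> = 0"
  by (simp add: nrm_eq_0)

lemma nrm_uminus: "x \<in> carrier A \<Longrightarrow> nrm A (\<ominus> x) = nrm A x"
  by (simp add: nrm_scale flip: scale_uminus)

lemma nrm_nonneg: assumes x: "x \<in> carrier A" shows "0 \<le> nrm A x"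
  using nrm_triangle[of x "\<ominus> x"] x by (simp add: nrm_uminus r_neg)

lemma nrm_minus_commute: assumes "x \<in> carrier A" "y \<in> carrier A" shows "nrm A (x \<ominus> y) = nrm A (y \<ominus> x)"
proof -
  have "\<ominus> (x \<ominus> y) = y \<ominus> x" using assms by (simp add: a_minus_def minus_add a_comm)
  then show ?thesis using nrm_uminus[of "x \<ominus> y"] assms by simp
qed

lemma nrm_minus_triangle: assumes "x \<in> carrier A" "y \<in> carrier A" "z \<in> carrier A"
  shows "nrm A (x \<ominus> z) \<le> nrm A (x \<ominus> y) + nrm A (y \<ominus> z)"
proof -
  have "x \<ominus> z = (x \<ominus> y) \<oplus> (y \<ominus> z)" using assms by (simp add: a_minus_def a_ac r_neg1 r_neg2)
  then show ?thesis using nrm_triangle[of "x \<ominus> y" "y \<ominus> z"] assms by simp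
qed

lemma nrm_diff_abs: assumes "x \<in> carrier A" "y \<in> carrier A"
  shows "\<bar>nrm A x - nrm A y\<bar> \<le> nrm A (x \<ominus> y)"
  using nrm_minus_triangle[of x y \<zero>] nrm_minus_triangle[of y x \<zero>] nrm_minus_commute[of x y] assms
  by (simp add: a_minus_def)

lemma minus_eq_zero: "x \<in> carrier A \<Longrightarrow> y \<in> carrier A \<Longrightarrow> x \<ominus> y = \<zero> \<longleftrightarrow> x = y"
  using minus_equality[of x "\<ominus> y"] by (auto simp: a_minus_def r_neg)

lemma nrm_adj_le: assumes x: "x \<in> carrier A" shows "nrm A x \<le> nrm A (adj A x)"
proof -
  have "(nrm A x)\<^sup>2 \<le> nrm A (adj A x) * nrm A x" using nrm_adj_mult[OF x] nrm_mult[of "adj A x" x] x by simp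
  then show ?thesis
    using nrm_nonneg[OF x] nrm_nonneg[of "adj A x"] x
    by (cases "nrm A x = 0") (auto simp: power2_eq_square)
qed

lemma nrm_adj: assumes x: "x \<in> carrier A" shows "nrm A (adj A x) = nrm A x"
  using nrm_adj_le[OF x] nrm_adj_le[of "adj A x"] x by (simp add: adj_adj)

definition lim_to :: "(nat \<Rightarrow> 'a) \<Rightarrow> 'a \<Rightarrow> bool" where
  "lim_to a b \<longleftrightarrow> (\<forall>i. a i \<in> carrier A) \<and> b \<in> carrier A \<and> (\<lambda>i. nrm A (a i \<ominus> b)) \<longlonglongrightarrow> 0"

lemma lim_toD: "lim_to a b \<Longrightarrow> a i \<in> carrier A" "lim_to a b \<Longrightarrow> b \<in> carrier A"
    "lim_to a b \<Longrightarrow> (\<lambda>i. nrm A (a i \<ominus> b)) \<longlonglongrightarrow> 0"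
  by (simp_all add: lim_to_def)

lemma lim_toI:
  assumes "\<And>i. a i \<in> carrier A" "b \<in> carrier A" "\<And>i. nrm A (a i \<ominus> b) \<le> u i" "u \<longlonglongrightarrow> 0"
  shows "lim_to a b"
  unfolding lim_to_def using assms
  by (auto intro!: null_comparison[OF _ assms(4)] simp: nrm_nonneg abs_of_nonneg)

lemma lim_to_const: "a \<in> carrier A \<Longrightarrow> lim_to (\<lambda>i. a) a"
  by (simp add: lim_to_def a_minus_def r_neg)

lemma lim_to_add: assumes a: "lim_to a x" and b: "lim_to b y" shows "lim_to (\<lambda>i. a i \<oplus> b i) (x \<oplus> y)"
proof (rule lim_toI)
  note [simp] = lim_toD(1,2)[OF a] lim_toD(1,2)[OF b]
  show "a i \<oplus> b i \<in> carrier A" "x \<oplus> y \<in> carrier A" for i by simp_all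
  have "(a i \<oplus> b i) \<ominus> (x \<oplus> y) = (a i \<ominus> x) \<oplus> (b i \<ominus> y)" for i
    by (simp add: a_minus_def minus_add a_ac)
  then show "nrm A ((a i \<oplus> b i) \<ominus> (x \<oplus> y)) \<le> nrm A (a i \<ominus> x) + nrm A (b i \<ominus> y)" for i
    using nrm_triangle[of "a i \<ominus> x" "b i \<ominus> y"] by simp
  show "(\<lambda>i. nrm A (a i \<ominus> x) + nrm A (b i \<ominus> y)) \<longlonglongrightarrow> 0"
    using tendsto_add[OF lim_toD(3)[OF a] lim_toD(3)[OF b]] by simp
qed

lemma lim_to_scale: assumes a: "lim_to a x" shows "lim_to (\<lambda>i. scale A c (a i)) (scale A c x)"
proof (rule lim_toI)
  note [simp] = lim_toD(1,2)[OF a]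
  show "scale A c (a i) \<in> carrier A" "scale A c x \<in> carrier A" for i by simp_all
  show "nrm A (scale A c (a i) \<ominus> scale A c x) \<le> cmod c * nrm A (a i \<ominus> x)" for i
    by (simp add: nrm_scale flip: scale_minus)
  show "(\<lambda>i. cmod c * nrm A (a i \<ominus> x)) \<longlonglongrightarrow> 0"
    using tendsto_mult_left[OF lim_toD(3)[OF a], of "cmod c"] by simp
qed

lemma lim_to_adj: assumes a: "lim_to a x" shows "lim_to (\<lambda>i. adj A (a i)) (adj A x)"
proof (rule lim_toI)
  note [simp] = lim_toD(1,2)[OF a]
  show "adj A (a i) \<in> carrier A" "adj A x \<in> carrier A" for i by simp_all
  show "nrm A (adj A (a i) \<ominus> adj A x) \<le> nrm A (a i \<ominus> x)" for i
    by (simp add: nrm_adj flip: adj_minus)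
qed (rule lim_toD(3)[OF a])

lemma lim_to_nrm: assumes a: "lim_to a x" shows "(\<lambda>i. nrm A (a i)) \<longlonglongrightarrow> nrm A x"
proof -
  have "(\<lambda>i. nrm A (a i) - nrm A x) \<longlonglongrightarrow> 0"
    by (rule null_comparison[OF nrm_diff_abs[OF lim_toD(1)[OF a] lim_toD(2)[OF a]] lim_toD(3)[OF a]])
  from tendsto_add[OF this tendsto_const[of "nrm A x"]] show ?thesis by simp
qed

lemma lim_to_mult: assumes a: "lim_to a x" and b: "lim_to b y" shows "lim_to (\<lambda>i. a i \<otimes> b i) (x \<otimes> y)"
proof (rule lim_toI)
  note [simp] = lim_toD(1,2)[OF a] lim_toD(1,2)[OF b]
  show "a i \<otimes> b i \<in> carrier A" "x \<otimes> y \<in> carrier A" for i by simp_all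
  show "nrm A (a i \<otimes> b i \<ominus> x \<otimes> y) \<le> nrm A (a i \<ominus> x) * nrm A (b i) + nrm A x * nrm A (b i \<ominus> y)" for i
  proof -
    have 1: "(a i \<ominus> x) \<otimes> b i = a i \<otimes> b i \<ominus> x \<otimes> b i" by (simp add: a_minus_def l_distr l_minus)
    have 2: "x \<otimes> (b i \<ominus> y) = x \<otimes> b i \<ominus> x \<otimes> y" by (simp add: a_minus_def r_distr r_minus)
    have "nrm A (a i \<otimes> b i \<ominus> x \<otimes> y) \<le> nrm A (a i \<otimes> b i \<ominus> x \<otimes> b i) + nrm A (x \<otimes> b i \<ominus> x \<otimes> y)"
      by (rule nrm_minus_triangle) simp_all
    also have "\<dots> \<le> nrm A (a i \<ominus> x) * nrm A (b i) + nrm A x * nrm A (b i \<ominus> y)"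
      unfolding 1[symmetric] 2[symmetric] by (intro add_mono nrm_mult) simp_all
    finally show ?thesis .
  qed
  show "(\<lambda>i. nrm A (a i \<ominus> x) * nrm A (b i) + nrm A x * nrm A (b i \<ominus> y)) \<longlonglongrightarrow> 0"
    using tendsto_add[OF tendsto_mult[OF lim_toD(3)[OF a] lim_to_nrm[OF b]] tendsto_mult_left[OF lim_toD(3)[OF b], of "nrm A x"]]
    by simp
qed

lemma lim_to_unique: assumes a: "lim_to a x" and b: "lim_to a y" shows "x = y"
proof -
  note [simp] = lim_toD(1,2)[OF a] lim_toD(1,2)[OF b]
  have "nrm A (x \<ominus> y) \<le> nrm A (a i \<ominus> x) + nrm A (a i \<ominus> y)" for i
    using nrm_minus_triangle[of x "a i" y] nrm_minus_commute[of x "a i"] by simp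
  then have "nrm A (x \<ominus> y) \<le> 0 + 0"
    by (intro lim_le[OF tendsto_const tendsto_add[OF lim_toD(3)[OF a] lim_toD(3)[OF b]]])
  then have "nrm A (x \<ominus> y) = 0" using nrm_nonneg[of "x \<ominus> y"] by simp
  then show ?thesis by (simp add: nrm_eq_0 minus_eq_zero)
qed

primrec letter_eval :: "('g \<Rightarrow> 'a) \<Rightarrow> 'g letter \<Rightarrow> 'a" where
  "letter_eval \<phi> (Gen g) = \<phi> g"
| "letter_eval \<phi> (Adj g) = adj A (\<phi> g)"

primrec word_eval :: "('g \<Rightarrow> 'a) \<Rightarrow> 'g letter list \<Rightarrow> 'a" where
  "word_eval \<phi> [] = \<one>"
| "word_eval \<phi> (l # w) = letter_eval \<phi> l \<otimes> word_eval \<phi> w"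

definition poly_eval :: "('g \<Rightarrow> 'a) \<Rightarrow> 'g star_poly \<Rightarrow> 'a" where
  "poly_eval \<phi> f = (\<Oplus>w\<in>Poly_Mapping.keys f. scale A (Poly_Mapping.lookup f w) (word_eval \<phi> w))"

context
  fixes \<phi> :: "'g \<Rightarrow> 'a" and G :: "'g set"
  assumes \<phi>: "g \<in> G \<Longrightarrow> \<phi> g \<in> carrier A"
begin

lemma letter_eval_closed: "l \<in> Gen ` G \<union> Adj ` G \<Longrightarrow> letter_eval \<phi> l \<in> carrier A"
  using \<phi> by auto

lemma word_eval_closed: "set w \<subseteq> Gen ` G \<union> Adj ` G \<Longrightarrow> word_eval \<phi> w \<in> carrier A"
  by (induction w) (use letter_eval_closed in auto)

lemma word_eval_append: "set v \<subseteq> Gen ` G \<union> Adj ` G \<Longrightarrow> set w \<subseteq> Gen ` G \<union> Adj ` G \<Longrightarrow>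
    word_eval \<phi> (v @ w) = word_eval \<phi> v \<otimes> word_eval \<phi> w"
proof (induction v)
  case (Cons l v)
  then show ?case using letter_eval_closed[of l] word_eval_closed[of v] word_eval_closed[of w]
    by (simp add: m_assoc)
qed (simp add: word_eval_closed)

lemma adj_letter_eval: "l \<in> Gen ` G \<union> Adj ` G \<Longrightarrow> letter_eval \<phi> (adj_letter l) = adj A (letter_eval \<phi> l)"
  using \<phi> by (auto simp: adj_adj)

lemma adj_letter_in: "l \<in> Gen ` G \<union> Adj ` G \<Longrightarrow> adj_letter l \<in> Gen ` G \<union> Adj ` G"
  by auto

lemma adj_word_in: "set w \<subseteq> Gen ` G \<union> Adj ` G \<Longrightarrow> set (rev (map adj_letter w)) \<subseteq> Gen ` G \<union> Adj ` G"
  using adj_letter_in by auto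

lemma adj_word_eval: "set w \<subseteq> Gen ` G \<union> Adj ` G \<Longrightarrow>
    word_eval \<phi> (rev (map adj_letter w)) = adj A (word_eval \<phi> w)"
proof (induction w)
  case (Cons l w)
  have l: "l \<in> Gen ` G \<union> Adj ` G" and w: "set w \<subseteq> Gen ` G \<union> Adj ` G" using Cons.prems by auto
  have "word_eval \<phi> (rev (map adj_letter w) @ [adj_letter l]) =
      word_eval \<phi> (rev (map adj_letter w)) \<otimes> word_eval \<phi> [adj_letter l]"
    using adj_letter_in[OF l] adj_word_in[OF w] by (intro word_eval_append) auto
  then show ?case
    using Cons.IH[OF w] adj_letter_eval[OF l] letter_eval_closed[OF l] word_eval_closed[OF w]
    by (simp add: adj_mult)
qed simp

lemma poly_eval_superset:
  assumes "finite K" "Poly_Mapping.keys f \<subseteq> K" "\<And>w. w \<in> K \<Longrightarrow> set w \<subseteq> Gen ` G \<union> Adj ` G"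
  shows "poly_eval \<phi> f = (\<Oplus>w\<in>K. scale A (Poly_Mapping.lookup f w) (word_eval \<phi> w))"
  unfolding poly_eval_def
  by (rule add.finprod_mono_neutral_cong_left)
    (use assms word_eval_closed in \<open>auto simp: in_keys_iff\<close>)

lemma poly_eval_closed [simp]: "f \<in> star_polys G \<Longrightarrow> poly_eval \<phi> f \<in> carrier A"
  unfolding poly_eval_def using word_eval_closed star_polysD[of f G] by (auto intro!: finsum_closed)

lemma poly_eval_add:
  assumes f: "f \<in> star_polys G" and g: "g \<in> star_polys G"
  shows "poly_eval \<phi> (f + g) = poly_eval \<phi> f \<oplus> poly_eval \<phi> g"
proof -
  let ?K = "Poly_Mapping.keys f \<union> Poly_Mapping.keys g"
  have K: "set w \<subseteq> Gen ` G \<union> Adj ` G" if "w \<in> ?K" for w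
    using that star_polysD[OF f] star_polysD[OF g] by blast
  have c: "word_eval \<phi> w \<in> carrier A" if "w \<in> ?K" for w by (rule word_eval_closed[OF K[OF that]])
  have "poly_eval \<phi> (f + g) = (\<Oplus>w\<in>?K. scale A (Poly_Mapping.lookup (f + g) w) (word_eval \<phi> w))"
    by (rule poly_eval_superset[OF _ keys_add K]) simp_all
  also have "\<dots> = (\<Oplus>w\<in>?K. scale A (Poly_Mapping.lookup f w) (word_eval \<phi> w) \<oplus>
      scale A (Poly_Mapping.lookup g w) (word_eval \<phi> w))"
    by (rule finsum_cong') (use c in \<open>auto simp: lookup_add add_scale\<close>)
  also have "\<dots> = (\<Oplus>w\<in>?K. scale A (Poly_Mapping.lookup f w) (word_eval \<phi> w)) \<oplus>
      (\<Oplus>w\<in>?K. scale A (Poly_Mapping.lookup g w) (word_eval \<phi> w))"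
    by (rule finsum_addf) (use c in auto)
  also have "\<dots> = poly_eval \<phi> f \<oplus> poly_eval \<phi> g"
    using poly_eval_superset[of ?K f] poly_eval_superset[of ?K g] K by auto
  finally show ?thesis .
qed

lemma poly_eval_0 [simp]: "poly_eval \<phi> 0 = \<zero>"
  by (simp add: poly_eval_def)

lemma poly_eval_single: "set w \<subseteq> Gen ` G \<union> Adj ` G \<Longrightarrow>
    poly_eval \<phi> (Poly_Mapping.single w c) = scale A c (word_eval \<phi> w)"
  using word_eval_closed[of w]
  by (cases "c = 0") (simp_all add: poly_eval_def)

lemma poly_eval_mult:
  assumes f: "f \<in> star_polys G" and g: "g \<in> star_polys G"
  shows "poly_eval \<phi> (f * g) = poly_eval \<phi> f \<otimes> poly_eval \<phi> g"
  using f
proof (induction rule: star_polys_induct)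
  case zero
  then show ?case using g by simp
next
  case (single v a)
  show ?case using g
  proof (induction rule: star_polys_induct)
    case zero
    show ?case using word_eval_closed[OF single] by (simp add: poly_eval_single[OF single])
  next
    case (single w b)
    note v = \<open>set v \<subseteq> Gen ` G \<union> Adj ` G\<close> and w = \<open>set w \<subseteq> Gen ` G \<union> Adj ` G\<close>
    have "set (v @ w) \<subseteq> Gen ` G \<union> Adj ` G" using v w by auto
    then show ?case
      using word_eval_closed[OF v] word_eval_closed[OF w]
      by (simp add: mult_single_append poly_eval_single v w word_eval_append scale_mult_left
          scale_mult_right scale_scale mult.commute del: set_append)
  next
    case (add f g)
    then show ?case using star_polys_single[OF single, of a]
      by (simp add: distrib_left poly_eval_add r_distr)
  qed
next
  case (add f' g')
  then show ?case using g by (simp add: distrib_right poly_eval_add l_distr)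
qed

lemma poly_eval_scalar: "poly_eval \<phi> (scalar c) = scale A c \<one>"
  unfolding scalar_def by (subst poly_eval_single) simp_all

lemma poly_eval_scale: "f \<in> star_polys G \<Longrightarrow> poly_eval \<phi> (scalar c * f) = scale A c (poly_eval \<phi> f)"
  by (simp add: poly_eval_mult poly_eval_scalar scale_mult_left)

lemma poly_eval_1: "poly_eval \<phi> 1 = \<one>"
  using poly_eval_scalar[of 1] by (simp add: scalar_1 scale_1)

lemma poly_eval_minus:
  assumes f: "f \<in> star_polys G" and g: "g \<in> star_polys G"
  shows "poly_eval \<phi> (f - g) = poly_eval \<phi> f \<ominus> poly_eval \<phi> g"
proof -
  have "f - g = f + scalar (-1) * g" by (simp add: scalar_uminus scalar_1)
  then have "poly_eval \<phi> (f - g) = poly_eval \<phi> (f + scalar (-1) * g)" by (rule arg_cong)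
  also have "\<dots> = poly_eval \<phi> f \<oplus> scale A (-1) (poly_eval \<phi> g)"
    using f g by (simp only: poly_eval_add star_polys_mult scalar_in poly_eval_scale)
  finally show ?thesis using g by (simp add: scale_uminus a_minus_def)
qed

lemma poly_eval_star: "f \<in> star_polys G \<Longrightarrow> poly_eval \<phi> (star f) = adj A (poly_eval \<phi> f)"
proof (induction rule: star_polys_induct)
  case (single w c)
  then show ?case
    using poly_eval_single[OF adj_word_in[OF single]] word_eval_closed[OF single]
    by (simp add: star_single poly_eval_single adj_word_eval adj_scale)
qed (simp_all add: star_add poly_eval_add adj_add)

lemma poly_eval_gen: "g \<in> G \<Longrightarrow> poly_eval \<phi> (gen g) = \<phi> g"
  unfolding gen_def using \<phi>[of g] by (subst poly_eval_single) (simp_all add: scale_1)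

lemma poly_eval_seminorm: "cstar_seminorm G (\<lambda>f. nrm A (poly_eval \<phi> f))"
  unfolding cstar_seminorm_def
proof (intro ballI conjI allI)
  fix f g :: "'g star_poly" and c assume f: "f \<in> star_polys G"
  show "nrm A (poly_eval \<phi> (scalar c * f)) = cmod c * nrm A (poly_eval \<phi> f)"
    using f by (simp only: poly_eval_scale nrm_scale poly_eval_closed)
  show "nrm A (poly_eval \<phi> (star f * f)) = (nrm A (poly_eval \<phi> f))\<^sup>2"
    using f by (simp add: poly_eval_mult poly_eval_star nrm_adj_mult)
  assume g: "g \<in> star_polys G"
  show "nrm A (poly_eval \<phi> (f + g)) \<le> nrm A (poly_eval \<phi> f) + nrm A (poly_eval \<phi> g)"
    using f g by (simp add: poly_eval_add nrm_triangle)
  show "nrm A (poly_eval \<phi> (f * g)) \<le> nrm A (poly_eval \<phi> f) * nrm A (poly_eval \<phi> g)"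
    using f g by (simp add: poly_eval_mult nrm_mult)
qed

end

end

subsection \<open>Presentations that bound the generators\<close>

locale bounded_presentation =
  fixes G :: "'g set" and R :: "'g star_poly set"
  assumes bdd: "f \<in> star_polys G \<Longrightarrow> \<exists>b. \<forall>p. cstar_seminorm G p \<and> (\<forall>r\<in>R. p r = 0) \<longrightarrow> p f \<le> b"
begin

abbreviation "N \<equiv> univ_seminorm G R"
abbreviation "adm p \<equiv> cstar_seminorm G p \<and> (\<forall>r\<in>R. p r = 0)"

lemma N_upper: "adm p \<Longrightarrow> f \<in> star_polys G \<Longrightarrow> p f \<le> N f"
  unfolding univ_seminorm_def using bdd[of f]
  by (intro cSup_upper bdd_aboveI2) (auto simp: bdd_above_def)

lemma adm_0: "adm (\<lambda>_. 0)"
  by (auto simp: cstar_seminorm_def)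

lemma N_least: "(\<And>p. adm p \<Longrightarrow> p f \<le> b) \<Longrightarrow> N f \<le> b"
  unfolding univ_seminorm_def using adm_0 by (intro cSup_least) auto

lemma N_nonneg: "f \<in> star_polys G \<Longrightarrow> 0 \<le> N f"
  using N_upper[OF adm_0] by simp

lemma N_triangle: "f \<in> star_polys G \<Longrightarrow> g \<in> star_polys G \<Longrightarrow> N (f + g) \<le> N f + N g"
  by (rule N_least) (smt (verit) N_upper cstar_seminorm_def)

lemma N_mult: "f \<in> star_polys G \<Longrightarrow> g \<in> star_polys G \<Longrightarrow> N (f * g) \<le> N f * N g"
proof (rule N_least)
  fix p assume f: "f \<in> star_polys G" and g: "g \<in> star_polys G" and p: "adm p"
  have "p (f * g) \<le> p f * p g" using p f g by (simp add: cstar_seminorm_def)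
  also have "\<dots> \<le> N f * N g"
    using p f g by (intro mult_mono N_upper N_nonneg cstar_seminorm_nonneg) auto
  finally show "p (f * g) \<le> N f * N g" .
qed

lemma N_scale: assumes f: "f \<in> star_polys G" shows "N (scalar c * f) = cmod c * N f"
proof (rule antisym)
  show "N (scalar c * f) \<le> cmod c * N f"
    using f by (intro N_least) (auto simp: cstar_seminorm_def intro!: mult_left_mono N_upper)
  show "cmod c * N f \<le> N (scalar c * f)"
  proof (cases "c = 0")
    case True
    then show ?thesis using f by (auto intro!: N_nonneg)
  next
    case False
    have "N f \<le> N (scalar c * f) / cmod c"
    proof (rule N_least)
      fix p assume p: "adm p"
      have "cmod c * p f = p (scalar c * f)" using p f by (simp add: cstar_seminorm_def)
      also have "\<dots> \<le> N (scalar c * f)" using p f by (intro N_upper) auto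
      finally show "p f \<le> N (scalar c * f) / cmod c" using False by (simp add: field_simps)
    qed
    then show ?thesis using False by (simp add: field_simps)
  qed
qed

lemma N_star_mult: assumes f: "f \<in> star_polys G" shows "N (star f * f) = (N f)\<^sup>2"
proof (rule antisym)
  show "N (star f * f) \<le> (N f)\<^sup>2"
  proof (rule N_least)
    fix p assume p: "adm p"
    have "p (star f * f) = (p f)\<^sup>2" using p f by (simp add: cstar_seminorm_def)
    also have "\<dots> \<le> (N f)\<^sup>2" using p f by (intro power_mono N_upper cstar_seminorm_nonneg) auto
    finally show "p (star f * f) \<le> (N f)\<^sup>2" .
  qed
  have "N f \<le> sqrt (N (star f * f))"
  proof (rule N_least)
    fix p assume p: "adm p"
    have "(p f)\<^sup>2 = p (star f * f)" using p f by (simp add: cstar_seminorm_def)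
    also have "\<dots> \<le> N (star f * f)" using p f by (intro N_upper) auto
    finally show "p f \<le> sqrt (N (star f * f))" by (rule real_le_rsqrt)
  qed
  then show "(N f)\<^sup>2 \<le> N (star f * f)"
    using N_nonneg[of f] N_nonneg[of "star f * f"] f
    by (metis power_mono real_sqrt_pow2 star_in star_polys_mult)
qed

lemma N_rel: "r \<in> R \<Longrightarrow> N r = 0"
proof -
  assume r: "r \<in> R"
  have "{p r | p. adm p} = {0}" using r adm_0 by auto
  then show ?thesis by (simp add: univ_seminorm_def)
qed

lemma N_adm: "adm N"
  using N_scale N_star_mult N_triangle N_mult N_rel unfolding cstar_seminorm_def by blast

lemma N_0 [simp]: "N 0 = 0"
  using N_scale[of 0 0] by (simp add: scalar_0)

lemma N_uminus: "f \<in> star_polys G \<Longrightarrow> N (- f) = N f"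
  using N_scale[of f "-1"] by (simp add: scalar_uminus scalar_1)

lemma N_minus_commute: "f \<in> star_polys G \<Longrightarrow> g \<in> star_polys G \<Longrightarrow> N (f - g) = N (g - f)"
  using N_uminus[of "f - g"] by simp

lemma N_diff_abs: "f \<in> star_polys G \<Longrightarrow> g \<in> star_polys G \<Longrightarrow> \<bar>N f - N g\<bar> \<le> N (f - g)"
  using N_triangle[of "f - g" g] N_triangle[of "g - f" f] N_minus_commute[of f g] by auto

lemma N_star: assumes f: "f \<in> star_polys G" shows "N (star f) = N f"
  using cstar_seminorm_star_le[of G N f] cstar_seminorm_star_le[of G N "star f"] N_adm f
  by (simp add: star_star)


abbreviation "C \<equiv> cauchy_ring G R"
abbreviation "I \<equiv> null_ideal G R"
abbreviation "U \<equiv> univ_cstar G R"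
abbreviation "cls X \<equiv> I +>\<^bsub>C\<^esub> X"

lemma C_simps: "mult C = (\<lambda>X Y i. X i * Y i)" "one C = (\<lambda>i. 1)" "zero C = (\<lambda>i. 0)"
    "add C = (\<lambda>X Y i. X i + Y i)"
  by (simp_all add: cauchy_ring_def)

lemma CD: "X \<in> carrier C \<Longrightarrow> X i \<in> star_polys G"
  by (simp add: cauchy_ring_def)

lemma C_cauchy: "X \<in> carrier C \<Longrightarrow> e > 0 \<Longrightarrow> \<exists>K. \<forall>i\<ge>K. \<forall>j\<ge>K. N (X i - X j) < e"
  by (simp add: cauchy_ring_def)

lemma CI: "(\<And>i. X i \<in> star_polys G) \<Longrightarrow>
    (\<And>e. e > 0 \<Longrightarrow> \<exists>K. \<forall>i\<ge>K. \<forall>j\<ge>K. N (X i - X j) < e) \<Longrightarrow> X \<in> carrier C"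
  by (simp add: cauchy_ring_def)

lemma const_in_C: "f \<in> star_polys G \<Longrightarrow> (\<lambda>i. f) \<in> carrier C"
  by (rule CI) auto

lemma C_dominated:
  assumes X: "X \<in> carrier C" and Y: "\<And>i. Y i \<in> star_polys G" and B: "B > 0"
    and le: "\<And>i j. N (Y i - Y j) \<le> B * N (X i - X j)"
  shows "Y \<in> carrier C"
proof (rule CI)
  fix e :: real assume "e > 0"
  then obtain K where K: "\<forall>i\<ge>K. \<forall>j\<ge>K. N (X i - X j) < e / B"
    using C_cauchy[OF X, of "e / B"] B by auto
  have "N (Y i - Y j) < e" if "i \<ge> K" "j \<ge> K" for i j
    using le[of i j] K[rule_format, OF that] B by (auto simp: field_simps)
  then show "\<exists>K. \<forall>i\<ge>K. \<forall>j\<ge>K. N (Y i - Y j) < e" by blast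
qed (rule Y)

lemma C_add: assumes X: "X \<in> carrier C" and Y: "Y \<in> carrier C" shows "(\<lambda>i. X i + Y i) \<in> carrier C"
proof (rule CI)
  fix e :: real assume "e > 0"
  then obtain K L where K: "\<forall>i\<ge>K. \<forall>j\<ge>K. N (X i - X j) < e / 2" and L: "\<forall>i\<ge>L. \<forall>j\<ge>L. N (Y i - Y j) < e / 2"
    using C_cauchy[OF X, of "e / 2"] C_cauchy[OF Y, of "e / 2"] by auto
  have "N (X i + Y i - (X j + Y j)) < e" if "i \<ge> max K L" "j \<ge> max K L" for i j
  proof -
    have "N (X i + Y i - (X j + Y j)) = N ((X i - X j) + (Y i - Y j))" by (simp add: algebra_simps)
    also have "\<dots> \<le> N (X i - X j) + N (Y i - Y j)"
      using CD[OF X] CD[OF Y] by (intro N_triangle) auto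
    also have "\<dots> < e" using K[rule_format, of i j] L[rule_format, of i j] that by auto
    finally show ?thesis .
  qed
  then show "\<exists>K. \<forall>i\<ge>K. \<forall>j\<ge>K. N (X i + Y i - (X j + Y j)) < e" by blast
qed (use CD[OF X] CD[OF Y] in auto)

lemma C_scale: assumes X: "X \<in> carrier C" shows "(\<lambda>i. scalar c * X i) \<in> carrier C"
proof (rule C_dominated[OF X, where B = "cmod c + 1"])
  fix i j
  have "N (scalar c * X i - scalar c * X j) = cmod c * N (X i - X j)"
    using CD[OF X] by (metis N_scale right_diff_distrib star_polys_diff)
  also have "\<dots> \<le> (cmod c + 1) * N (X i - X j)"
    using CD[OF X] by (intro mult_right_mono N_nonneg) auto
  finally show "N (scalar c * X i - scalar c * X j) \<le> (cmod c + 1) * N (X i - X j)" .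
qed (use CD[OF X] in \<open>auto simp: add_nonneg_pos\<close>)

lemma C_uminus: "X \<in> carrier C \<Longrightarrow> (\<lambda>i. - X i) \<in> carrier C"
  using C_scale[of X "-1"] by (simp add: scalar_uminus scalar_1)

lemma C_diff: "X \<in> carrier C \<Longrightarrow> Y \<in> carrier C \<Longrightarrow> (\<lambda>i. X i - Y i) \<in> carrier C"
  using C_add[of X "\<lambda>i. - Y i"] C_uminus[of Y] by simp

lemma C_star: assumes X: "X \<in> carrier C" shows "(\<lambda>i. star (X i)) \<in> carrier C"
proof (rule C_dominated[OF X, where B = 1])
  fix i j show "N (star (X i) - star (X j)) \<le> 1 * N (X i - X j)"
    using CD[OF X] N_star[of "X i - X j"] by (simp add: star_minus)
qed (use CD[OF X] in auto)

lemma C_norm_conv: assumes X: "X \<in> carrier C" shows "\<exists>r. (\<lambda>i. N (X i)) \<longlonglongrightarrow> r"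
proof -
  have "Cauchy (\<lambda>i. N (X i))"
  proof (rule metric_CauchyI)
    fix e :: real assume "e > 0"
    then obtain K where K: "\<forall>i\<ge>K. \<forall>j\<ge>K. N (X i - X j) < e" using C_cauchy[OF X] by blast
    have "dist (N (X i)) (N (X j)) < e" if "i \<ge> K" "j \<ge> K" for i j
      using K[rule_format, OF that] N_diff_abs[OF CD[OF X] CD[OF X], of i j] by (simp add: dist_real_def)
    then show "\<exists>K. \<forall>i\<ge>K. \<forall>j\<ge>K. dist (N (X i)) (N (X j)) < e" by blast
  qed
  then show ?thesis using Cauchy_convergent convergent_def by blast
qed

lemma C_bounded: assumes X: "X \<in> carrier C" shows "\<exists>B>0. \<forall>i. N (X i) \<le> B"
proof -
  obtain r where "(\<lambda>i. N (X i)) \<longlonglongrightarrow> r" using C_norm_conv[OF X] by blast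
  then have "Bseq (\<lambda>i. N (X i))" using convergentI convergent_imp_Bseq by blast
  then obtain B where "B > 0" "\<And>i. norm (N (X i)) \<le> B" by (auto elim: BseqE)
  then show ?thesis using abs_le_D1 by auto
qed

lemma C_mult: assumes X: "X \<in> carrier C" and Y: "Y \<in> carrier C" shows "(\<lambda>i. X i * Y i) \<in> carrier C"
proof (rule CI)
  fix e :: real assume e: "e > 0"
  obtain A where A: "A > 0" "\<And>i. N (X i) \<le> A" using C_bounded[OF X] by blast
  obtain B where B: "B > 0" "\<And>i. N (Y i) \<le> B" using C_bounded[OF Y] by blast
  obtain K L where K: "\<forall>i\<ge>K. \<forall>j\<ge>K. N (X i - X j) < e / (2 * B)"
    and L: "\<forall>i\<ge>L. \<forall>j\<ge>L. N (Y i - Y j) < e / (2 * A)"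
    using C_cauchy[OF X, of "e / (2 * B)"] C_cauchy[OF Y, of "e / (2 * A)"] e A B by auto
  have "N (X i * Y i - X j * Y j) < e" if "i \<ge> max K L" "j \<ge> max K L" for i j
  proof -
    have "N (X i * Y i - X j * Y j) = N ((X i - X j) * Y i + X j * (Y i - Y j))"
      by (simp add: algebra_simps)
    also have "\<dots> \<le> N ((X i - X j) * Y i) + N (X j * (Y i - Y j))"
      using CD[OF X] CD[OF Y] by (intro N_triangle) auto
    also have "\<dots> \<le> N (X i - X j) * N (Y i) + N (X j) * N (Y i - Y j)"
      using CD[OF X] CD[OF Y] by (intro add_mono N_mult) auto
    also have "\<dots> \<le> N (X i - X j) * B + A * N (Y i - Y j)"
      using CD[OF X] CD[OF Y] A B by (intro add_mono mult_mono N_nonneg) auto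
    also have "\<dots> < e / 2 + e / 2"
    proof (rule add_strict_mono)
      show "N (X i - X j) * B < e / 2" using K[rule_format, of i j] that B by (simp add: field_simps)
      show "A * N (Y i - Y j) < e / 2" using L[rule_format, of i j] that A by (simp add: field_simps)
    qed
    finally show ?thesis by simp
  qed
  then show "\<exists>K. \<forall>i\<ge>K. \<forall>j\<ge>K. N (X i * Y i - X j * Y j) < e" by blast
qed (use CD[OF X] CD[OF Y] in auto)

lemma ring_C: "ring C"
proof (rule ringI)
  show "abelian_group C"
  proof (rule abelian_groupI)
    fix X assume "X \<in> carrier C"
    then show "\<exists>Y\<in>carrier C. Y \<oplus>\<^bsub>C\<^esub> X = \<zero>\<^bsub>C\<^esub>"
      by (intro bexI[of _ "\<lambda>i. - X i"]) (simp_all add: C_simps C_uminus)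
  qed (simp_all add: C_simps C_add const_in_C algebra_simps)
  show "Group.monoid C"
    by (rule monoidI) (simp_all add: C_simps C_mult const_in_C algebra_simps)
qed (simp_all add: C_simps algebra_simps)

interpretation C: ring C by (rule ring_C)

lemma C_uminus_eq: "X \<in> carrier C \<Longrightarrow> \<ominus>\<^bsub>C\<^esub> X = (\<lambda>i. - X i)"
  by (rule C.minus_equality) (simp_all add: C_simps C_uminus)

lemma ID: "X \<in> I \<Longrightarrow> X \<in> carrier C" "X \<in> I \<Longrightarrow> (\<lambda>i. N (X i)) \<longlonglongrightarrow> 0"
  by (simp_all add: null_ideal_def)

lemma II: "X \<in> carrier C \<Longrightarrow> (\<lambda>i. N (X i)) \<longlonglongrightarrow> 0 \<Longrightarrow> X \<in> I"
  by (simp add: null_ideal_def)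

lemma I_dominated:
  assumes "X \<in> I" "Y \<in> carrier C" "\<And>i. N (Y i) \<le> B * N (X i)" shows "Y \<in> I"
proof (rule II)
  have "(\<lambda>i. B * N (X i)) \<longlonglongrightarrow> 0" using tendsto_mult_left[OF ID(2)[OF assms(1)], of B] by simp
  then show "(\<lambda>i. N (Y i)) \<longlonglongrightarrow> 0"
  proof (rule null_comparison[rotated])
    show "\<bar>N (Y i)\<bar> \<le> B * N (X i)" for i
      using assms(3)[of i] N_nonneg[OF CD[OF assms(2)], of i] by simp
  qed
qed (rule assms)

lemma ideal_I: "ideal I C"
proof (rule idealI[OF ring_C])
  show "subgroup I (add_monoid C)"
  proof (rule group.subgroupI[OF C.a_group])
    show "I \<subseteq> carrier (add_monoid C)" by (auto dest: ID)
    have "(\<lambda>i. 0) \<in> I" by (rule II) (simp_all add: const_in_C)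
    then show "I \<noteq> {}" by blast
  next
    fix X assume X: "X \<in> I"
    have "\<ominus>\<^bsub>C\<^esub> X \<in> I"
      unfolding C_uminus_eq[OF ID(1)[OF X]]
      by (rule I_dominated[OF X, where B = 1]) (use ID(1)[OF X] in \<open>auto simp: C_uminus N_uminus CD\<close>)
    then show "inv\<^bsub>add_monoid C\<^esub> X \<in> I" by (simp add: a_inv_def)
  next
    fix X Y assume X: "X \<in> I" and Y: "Y \<in> I"
    have "(\<lambda>i. X i + Y i) \<in> I"
    proof (rule II)
      show "(\<lambda>i. N (X i + Y i)) \<longlonglongrightarrow> 0"
      proof (rule null_comparison)
        show "\<bar>N (X i + Y i)\<bar> \<le> N (X i) + N (Y i)" for i
          using N_triangle[OF CD[OF ID(1)[OF X]] CD[OF ID(1)[OF Y]]]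
            N_nonneg[OF star_polys_add[OF CD[OF ID(1)[OF X]] CD[OF ID(1)[OF Y]]]] by simp
        show "(\<lambda>i. N (X i) + N (Y i)) \<longlonglongrightarrow> 0"
          using tendsto_add[OF ID(2)[OF X] ID(2)[OF Y]] by simp
      qed
    qed (use C_add ID(1) X Y in auto)
    then show "X \<otimes>\<^bsub>add_monoid C\<^esub> Y \<in> I" by (simp add: C_simps)
  qed
next
  fix X Y assume X: "X \<in> I" and Y: "Y \<in> carrier C"
  obtain B where B: "B > 0" "\<And>i. N (Y i) \<le> B" using C_bounded[OF Y] by blast
  have "N (Y i * X i) \<le> B * N (X i)" "N (X i * Y i) \<le> B * N (X i)" for i
  proof -
    have "N (Y i * X i) \<le> N (Y i) * N (X i)" by (intro N_mult CD[OF Y] CD[OF ID(1)[OF X]])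
    also have "\<dots> \<le> B * N (X i)" by (intro mult_right_mono B N_nonneg CD[OF ID(1)[OF X]])
    finally show "N (Y i * X i) \<le> B * N (X i)" .
    have "N (X i * Y i) \<le> N (X i) * N (Y i)" by (intro N_mult CD[OF Y] CD[OF ID(1)[OF X]])
    also have "\<dots> \<le> N (X i) * B" by (intro mult_left_mono B N_nonneg CD[OF ID(1)[OF X]])
    finally show "N (X i * Y i) \<le> B * N (X i)" by (simp add: mult.commute)
  qed
  then show "Y \<otimes>\<^bsub>C\<^esub> X \<in> I" "X \<otimes>\<^bsub>C\<^esub> Y \<in> I"
    unfolding C_simps by (auto intro!: I_dominated[OF X] C_mult ID(1)[OF X] Y)
qed

interpretation I: ideal I C by (rule ideal_I)

lemma U_simps: "carrier U = carrier (C Quot I)" "mult U = mult (C Quot I)" "one U = one (C Quot I)"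
    "zero U = zero (C Quot I)" "add U = add (C Quot I)"
  by (simp_all add: univ_cstar_def ring.defs)

lemma ring_U: "ring U"
proof -
  interpret Q: ring "C Quot I" by (rule I.quotient_is_ring)
  show ?thesis
  proof (rule ringI)
    show "abelian_group U"
      by (rule abelian_groupI)
        (use Q.a_assoc Q.a_comm Q.l_zero Q.l_neg Q.a_inv_closed in \<open>auto simp add: U_simps\<close>)
    show "Group.monoid U"
      by (rule monoidI) (use Q.m_assoc in \<open>simp_all add: U_simps\<close>)
  qed (simp_all add: U_simps Q.l_distr Q.r_distr)
qed

interpretation U: ring U by (rule ring_U)

lemma cls_hom: "ring_hom_ring C U (\<lambda>X. cls X)"
proof (rule ring_hom_ringI2[OF ring_C ring_U])
  show "(\<lambda>X. cls X) \<in> ring_hom C U"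
    using I.rcos_ring_hom by (simp add: ring_hom_def U_simps)
qed

interpretation cls: ring_hom_ring C U "\<lambda>X. cls X" by (rule cls_hom)

lemma U_cases: assumes "x \<in> carrier U" obtains X where "X \<in> carrier C" "x = cls X"
  using assms unfolding U_simps FactRing_def A_RCOSETS_def' by auto

lemma mem_cls: "X \<in> carrier C \<Longrightarrow> Y \<in> cls X \<longleftrightarrow> Y \<in> carrier C \<and> (\<lambda>i. Y i - X i) \<in> I"
proof
  assume X: "X \<in> carrier C" and "Y \<in> cls X"
  then obtain Z where "Z \<in> I" "Y = (\<lambda>i. Z i + X i)" by (auto simp: a_r_coset_def' C_simps)
  then show "Y \<in> carrier C \<and> (\<lambda>i. Y i - X i) \<in> I" using C_add[OF ID(1)] X by auto
next
  assume X: "X \<in> carrier C" and Y: "Y \<in> carrier C \<and> (\<lambda>i. Y i - X i) \<in> I"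
  have "Y = (\<lambda>i. (Y i - X i) + X i)" by auto
  then show "Y \<in> cls X" using Y unfolding a_r_coset_def' C_simps by blast
qed

lemma cls_eq: "X \<in> carrier C \<Longrightarrow> Y \<in> carrier C \<Longrightarrow> cls Y = cls X \<longleftrightarrow> (\<lambda>i. Y i - X i) \<in> I"
proof
  assume X: "X \<in> carrier C" and Y: "Y \<in> carrier C"
  show "(\<lambda>i. Y i - X i) \<in> I" if "cls Y = cls X"
    using that mem_cls[OF X, of Y] I.a_rcos_self[OF Y] by simp
  assume "(\<lambda>i. Y i - X i) \<in> I"
  then have "Y \<in> cls X" using mem_cls[OF X, of Y] Y by simp
  from C.a_repr_independence[OF this X I.a_subgroup] show "cls Y = cls X" by simp
qed

lemma cls_lift:
  assumes X: "X \<in> carrier C" and F: "\<And>Y. Y \<in> carrier C \<Longrightarrow> F Y \<in> carrier C"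
    and FI: "\<And>Y. Y \<in> carrier C \<Longrightarrow> (\<lambda>i. Y i - X i) \<in> I \<Longrightarrow> (\<lambda>i. F Y i - F X i) \<in> I"
  shows "(\<Union>Y\<in>cls X. cls (F Y)) = cls (F X)"
proof -
  have "cls (F Y) = cls (F X)" if "Y \<in> cls X" for Y
    using that mem_cls[OF X] cls_eq F FI X by auto
  moreover have "X \<in> cls X" using I.a_rcos_self[OF X] .
  ultimately show ?thesis by blast
qed

lemma scale_cls: assumes X: "X \<in> carrier C" shows "scale U c (cls X) = cls (\<lambda>i. scalar c * X i)"
proof -
  have "scale U c (cls X) = (\<Union>Y\<in>cls X. cls (\<lambda>i. scalar c * Y i))"
    by (simp add: univ_cstar_def ring.defs)
  also have "\<dots> = cls (\<lambda>i. scalar c * X i)"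
  proof (rule cls_lift[OF X])
    fix Y assume Y: "Y \<in> carrier C" and YX: "(\<lambda>i. Y i - X i) \<in> I"
    show "(\<lambda>i. scalar c * Y i - scalar c * X i) \<in> I"
    proof (rule I_dominated[OF YX])
      fix i show "N (scalar c * Y i - scalar c * X i) \<le> cmod c * N (Y i - X i)"
        using N_scale[of "Y i - X i" c] CD X Y by (simp add: algebra_simps)
    qed (intro C_diff C_scale X Y)
  qed (rule C_scale)
  finally show ?thesis .
qed

lemma adj_cls: assumes X: "X \<in> carrier C" shows "adj U (cls X) = cls (\<lambda>i. star (X i))"
proof -
  have "adj U (cls X) = (\<Union>Y\<in>cls X. cls (\<lambda>i. star (Y i)))"
    by (simp add: univ_cstar_def ring.defs)
  also have "\<dots> = cls (\<lambda>i. star (X i))"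
  proof (rule cls_lift[OF X])
    fix Y assume Y: "Y \<in> carrier C" and YX: "(\<lambda>i. Y i - X i) \<in> I"
    show "(\<lambda>i. star (Y i) - star (X i)) \<in> I"
    proof (rule I_dominated[OF YX])
      fix i show "N (star (Y i) - star (X i)) \<le> 1 * N (Y i - X i)"
        using N_star[of "Y i - X i"] CD X Y by (simp add: star_minus)
    qed (intro C_diff C_star X Y)
  qed (rule C_star)
  finally show ?thesis .
qed

lemma nrm_cls: assumes X: "X \<in> carrier C" shows "(\<lambda>i. N (X i)) \<longlonglongrightarrow> nrm U (cls X)"
proof -
  obtain r where r: "(\<lambda>i. N (X i)) \<longlonglongrightarrow> r" using C_norm_conv[OF X] by blast
  have all: "(\<lambda>i. N (Y i)) \<longlonglongrightarrow> r" if "Y \<in> cls X" for Y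
  proof -
    have Y: "Y \<in> carrier C" and YX: "(\<lambda>i. Y i - X i) \<in> I" using that mem_cls[OF X] by auto
    have "(\<lambda>i. N (Y i) - N (X i)) \<longlonglongrightarrow> 0"
      by (rule null_comparison[OF N_diff_abs[OF CD[OF Y] CD[OF X]] ID(2)[OF YX]])
    from tendsto_add[OF this r] show ?thesis by simp
  qed
  have "nrm U (cls X) = (THE r. \<forall>Y\<in>cls X. (\<lambda>i. N (Y i)) \<longlonglongrightarrow> r)"
    by (simp add: univ_cstar_def ring.defs)
  also have "\<dots> = r"
    using all I.a_rcos_self[OF X] LIMSEQ_unique by (intro the_equality) blast+
  finally show ?thesis using r by simp
qed

lemma cls_add: "X \<in> carrier C \<Longrightarrow> Y \<in> carrier C \<Longrightarrow> cls X \<oplus>\<^bsub>U\<^esub> cls Y = cls (\<lambda>i. X i + Y i)"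
  using cls.hom_add[of X Y] by (simp add: C_simps)

lemma cls_mult: "X \<in> carrier C \<Longrightarrow> Y \<in> carrier C \<Longrightarrow> cls X \<otimes>\<^bsub>U\<^esub> cls Y = cls (\<lambda>i. X i * Y i)"
  using cls.hom_mult[of X Y] by (simp add: C_simps)

lemma cls_minus: "X \<in> carrier C \<Longrightarrow> Y \<in> carrier C \<Longrightarrow> cls X \<ominus>\<^bsub>U\<^esub> cls Y = cls (\<lambda>i. X i - Y i)"
  using cls_add[of X "\<lambda>i. - Y i"] C_uminus[of Y] cls.hom_a_inv[of Y]
  by (simp add: a_minus_def C_uminus_eq)

lemma cls_one: "\<one>\<^bsub>U\<^esub> = cls (\<lambda>i. 1)"
  using cls.hom_one by (simp add: C_simps)

lemma cls_zero: "\<zero>\<^bsub>U\<^esub> = cls (\<lambda>i. 0)"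
  using cls.hom_zero by (simp add: C_simps)

lemma nrm_const: "f \<in> star_polys G \<Longrightarrow> nrm U (cls (\<lambda>i. f)) = N f"
  by (rule LIMSEQ_unique[OF nrm_cls[OF const_in_C] tendsto_const])

lemma const_dense: assumes X: "X \<in> carrier C" and e: "e > 0"
  shows "\<exists>f\<in>star_polys G. nrm U (cls X \<ominus>\<^bsub>U\<^esub> cls (\<lambda>i. f)) \<le> e"
proof -
  obtain K where K: "\<forall>i\<ge>K. \<forall>j\<ge>K. N (X i - X j) < e" using C_cauchy[OF X e] by blast
  have "nrm U (cls (\<lambda>i. X i - X K)) \<le> e"
    by (rule lim_le[OF nrm_cls[OF C_diff[OF X const_in_C[OF CD[OF X]]]] tendsto_const, of K])
      (use K in \<open>auto intro: less_imp_le\<close>)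
  then show ?thesis using CD[OF X] by (intro bexI[of _ "X K"]) (simp_all add: cls_minus X const_in_C)
qed

lemma nrm_U_triangle: assumes "x \<in> carrier U" "y \<in> carrier U"
  shows "nrm U (x \<oplus>\<^bsub>U\<^esub> y) \<le> nrm U x + nrm U y"
proof -
  obtain X Y where X: "X \<in> carrier C" "x = cls X" and Y: "Y \<in> carrier C" "y = cls Y"
    using assms by (auto elim!: U_cases)
  show ?thesis unfolding X(2) Y(2) cls_add[OF X(1) Y(1)]
    by (rule lim_le[OF nrm_cls[OF C_add[OF X(1) Y(1)]] tendsto_add[OF nrm_cls[OF X(1)] nrm_cls[OF Y(1)]]])
      (rule N_triangle[OF CD[OF X(1)] CD[OF Y(1)]])
qed

lemma nrm_U_complete:
  assumes x: "\<And>i. x i \<in> carrier U"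
    and cau: "\<And>e. e > 0 \<Longrightarrow> \<exists>K. \<forall>i\<ge>K. \<forall>j\<ge>K. nrm U (x i \<ominus>\<^bsub>U\<^esub> x j) < e"
  shows "\<exists>y\<in>carrier U. (\<lambda>i. nrm U (x i \<ominus>\<^bsub>U\<^esub> y)) \<longlonglongrightarrow> 0"
proof -
  have "\<exists>f\<in>star_polys G. nrm U (x i \<ominus>\<^bsub>U\<^esub> cls (\<lambda>_. f)) \<le> inverse (real (Suc i))" for i
  proof -
    obtain X where X: "X \<in> carrier C" "x i = cls X" by (rule U_cases[OF x[of i]])
    show ?thesis unfolding X(2) by (rule const_dense[OF X(1)]) simp
  qed
  then obtain f where f: "\<And>i. f i \<in> star_polys G"
    and fx: "\<And>i. nrm U (x i \<ominus>\<^bsub>U\<^esub> cls (\<lambda>_. f i)) \<le> inverse (real (Suc i))" by metis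
  define c where "c = (\<lambda>i. cls (\<lambda>_. f i))"
  have c: "c i \<in> carrier U" for i unfolding c_def using cls.hom_closed const_in_C f by blast
  have fx: "nrm U (x i \<ominus>\<^bsub>U\<^esub> c i) \<le> inverse (real (Suc i))" for i using fx c_def by simp
  have cc: "nrm U (c i \<ominus>\<^bsub>U\<^esub> c j) = N (f i - f j)" for i j
    unfolding c_def using f by (simp add: cls_minus const_in_C nrm_const)
  have sym: "nrm U (a \<ominus>\<^bsub>U\<^esub> b) = nrm U (b \<ominus>\<^bsub>U\<^esub> a)" if a: "a \<in> carrier U" and b: "b \<in> carrier U" for a b
  proof -
    obtain A B where A: "A \<in> carrier C" "a = cls A" and B: "B \<in> carrier C" "b = cls B"
      using a b by (auto elim!: U_cases)
    have "(\<lambda>i. N (A i - B i)) = (\<lambda>i. N (B i - A i))"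
      using N_minus_commute[OF CD[OF A(1)] CD[OF B(1)]] by (rule ext)
    then have "(\<lambda>i. N (A i - B i)) \<longlonglongrightarrow> nrm U (cls (\<lambda>i. B i - A i))"
      using nrm_cls[OF C_diff[OF B(1) A(1)]] by simp
    then show ?thesis unfolding A(2) B(2) cls_minus[OF A(1) B(1)] cls_minus[OF B(1) A(1)]
      by (rule LIMSEQ_unique[OF nrm_cls[OF C_diff[OF A(1) B(1)]]])
  qed
  have tri: "nrm U (a \<ominus>\<^bsub>U\<^esub> b) \<le> nrm U (a \<ominus>\<^bsub>U\<^esub> d) + nrm U (d \<ominus>\<^bsub>U\<^esub> b)"
    if abd: "a \<in> carrier U" "b \<in> carrier U" "d \<in> carrier U" for a b d
  proof -
    obtain A B D where A: "A \<in> carrier C" "a = cls A" and B: "B \<in> carrier C" "b = cls B"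
      and D: "D \<in> carrier C" "d = cls D" using abd by (auto elim!: U_cases)
    have "a \<ominus>\<^bsub>U\<^esub> b = (a \<ominus>\<^bsub>U\<^esub> d) \<oplus>\<^bsub>U\<^esub> (d \<ominus>\<^bsub>U\<^esub> b)"
      unfolding A(2) B(2) D(2) cls_minus[OF A(1) B(1)] cls_minus[OF A(1) D(1)] cls_minus[OF D(1) B(1)]
        cls_add[OF C_diff[OF A(1) D(1)] C_diff[OF D(1) B(1)]] by simp
    then show ?thesis
      using nrm_U_triangle[OF U.minus_closed U.minus_closed, of a d d b] abd by simp
  qed
  have inv0: "(\<lambda>i. inverse (real (Suc i))) \<longlonglongrightarrow> 0" by (rule LIMSEQ_inverse_real_of_nat)
  have fC: "f \<in> carrier C"
  proof (rule CI[OF f])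
    fix e :: real assume e: "e > 0"
    obtain K where K: "\<forall>i\<ge>K. \<forall>j\<ge>K. nrm U (x i \<ominus>\<^bsub>U\<^esub> x j) < e / 3" using cau[of "e / 3"] e by auto
    obtain L where L: "\<forall>i\<ge>L. inverse (real (Suc i)) < e / 3"
      using order_tendstoD(2)[OF inv0, of "e / 3"] e by (auto simp: eventually_sequentially)
    have "N (f i - f j) < e" if "i \<ge> max K L" "j \<ge> max K L" for i j
      using tri[OF c c x, of i j i] tri[OF x c x, of i j j] sym[OF c x, of i i] fx[of i] fx[of j] cc[of i j]
        K[rule_format, of i j] L[rule_format, of i] L[rule_format, of j] that by simp
    then show "\<exists>K. \<forall>i\<ge>K. \<forall>j\<ge>K. N (f i - f j) < e" by blast
  qed
  let ?y = "cls f"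
  have y: "?y \<in> carrier U" using cls.hom_closed fC by blast
  have "(\<lambda>i. nrm U (x i \<ominus>\<^bsub>U\<^esub> ?y)) \<longlonglongrightarrow> 0"
  proof (rule LIMSEQ_I)
    fix e :: real assume e: "e > 0"
    obtain K where K: "\<forall>i\<ge>K. \<forall>j\<ge>K. N (f i - f j) < e / 3" using C_cauchy[OF fC, of "e / 3"] e by auto
    obtain L where L: "\<forall>i\<ge>L. inverse (real (Suc i)) < e / 3"
      using order_tendstoD(2)[OF inv0, of "e / 3"] e by (auto simp: eventually_sequentially)
    have nn: "0 \<le> nrm U a" if a: "a \<in> carrier U" for a
    proof -
      obtain A where A: "A \<in> carrier C" "a = cls A" by (rule U_cases[OF a])
      show ?thesis unfolding A(2)
        using nrm_cls[OF A(1)] by (rule LIMSEQ_le_const) (auto intro!: N_nonneg CD A)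
    qed
    have "norm (nrm U (x i \<ominus>\<^bsub>U\<^esub> ?y) - 0) < e" if i: "i \<ge> max K L" for i
    proof -
      have "nrm U (c i \<ominus>\<^bsub>U\<^esub> ?y) \<le> e / 3"
        unfolding c_def cls_minus[OF const_in_C[OF f] fC]
        by (rule lim_le[OF nrm_cls[OF C_diff[OF const_in_C[OF f] fC]] tendsto_const, of K])
          (use K i in \<open>auto intro: less_imp_le\<close>)
      then show ?thesis
        using tri[OF x y c, of i i] fx[of i] L[rule_format, of i] i e nn[OF U.minus_closed[OF x y], of i] by simp
    qed
    then show "\<exists>n0. \<forall>i\<ge>n0. norm (nrm U (x i \<ominus>\<^bsub>U\<^esub> ?y) - 0) < e" by blast
  qed
  with y show ?thesis by blast
qed

theorem univ_cstar_is_cstar: "unital_cstar_algebra U"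
proof (intro unital_cstar_algebra.intro ring_U unital_cstar_algebra_axioms.intro)
  fix x :: "(nat \<Rightarrow> 'g star_poly) set" and c :: complex assume "x \<in> carrier U"
  then obtain X where X: "X \<in> carrier C" "x = cls X" by (auto elim!: U_cases)
  note lim = LIMSEQ_unique[OF nrm_cls]
  show "scale U c x \<in> carrier U" "adj U x \<in> carrier U"
    using X by (simp_all add: scale_cls adj_cls C_scale C_star)
  show "scale U (c + d) x = scale U c x \<oplus>\<^bsub>U\<^esub> scale U d x" for d
    using X by (simp add: scale_cls cls_add C_scale scalar_add algebra_simps)
  show "scale U c (scale U d x) = scale U (c * d) x" for d
    using X by (simp add: scale_cls C_scale flip: scalar_mult mult.assoc)
  show "scale U 1 x = x" using X by (simp add: scale_cls scalar_1)
  show "adj U (adj U x) = x" using X by (simp add: adj_cls C_star star_star)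
  show "adj U (scale U c x) = scale U (cnj c) (adj U x)"
  proof -
    have "star (scalar c * X i) = scalar (cnj c) * star (X i)" for i
      by (simp add: star_mult star_scalar scalar_commute[of "cnj c"])
    then show ?thesis using X by (simp add: adj_cls scale_cls C_star C_scale)
  qed
  show "nrm U (scale U c x) = cmod c * nrm U x"
    unfolding X(2) scale_cls[OF X(1)]
    by (rule lim[OF C_scale[OF X(1)]])
      (use N_scale[OF CD[OF X(1)]] tendsto_mult_left[OF nrm_cls[OF X(1)]] in simp)
  show "nrm U (adj U x \<otimes>\<^bsub>U\<^esub> x) = (nrm U x)\<^sup>2"
    unfolding X(2) adj_cls[OF X(1)] cls_mult[OF C_star[OF X(1)] X(1)]
    by (rule lim[OF C_mult[OF C_star[OF X(1)] X(1)]])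
      (use N_star_mult[OF CD[OF X(1)]] tendsto_power[OF nrm_cls[OF X(1)]] in simp)
  show "nrm U x = 0 \<longleftrightarrow> x = \<zero>\<^bsub>U\<^esub>"
  proof -
    have 1: "x = \<zero>\<^bsub>U\<^esub> \<longleftrightarrow> X \<in> I"
      unfolding X(2) cls_zero using cls_eq[OF const_in_C[OF star_polys_0] X(1)] by simp
    show ?thesis unfolding 1
    proof
      assume "X \<in> I"
      from LIMSEQ_unique[OF nrm_cls[OF X(1)] ID(2)[OF this]] show "nrm U x = 0" unfolding X(2) .
    next
      assume "nrm U x = 0"
      then have "(\<lambda>i. N (X i)) \<longlonglongrightarrow> 0" using nrm_cls[OF X(1)] unfolding X(2) by simp
      then show "X \<in> I" by (rule II[OF X(1)])
    qed
  qed
  fix y :: "(nat \<Rightarrow> 'g star_poly) set" assume "y \<in> carrier U"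
  then obtain Y where Y: "Y \<in> carrier C" "y = cls Y" by (auto elim!: U_cases)
  show "scale U c (x \<oplus>\<^bsub>U\<^esub> y) = scale U c x \<oplus>\<^bsub>U\<^esub> scale U c y"
    using X Y by (simp add: cls_add scale_cls C_scale C_add algebra_simps del: cls.hom_add)
  show "adj U (x \<oplus>\<^bsub>U\<^esub> y) = adj U x \<oplus>\<^bsub>U\<^esub> adj U y"
    using X Y by (simp add: cls_add adj_cls C_star C_add star_add del: cls.hom_add)
  show "adj U (x \<otimes>\<^bsub>U\<^esub> y) = adj U y \<otimes>\<^bsub>U\<^esub> adj U x"
    using X Y by (simp add: cls_mult adj_cls C_star C_mult star_mult del: cls.hom_mult)
  show "scale U c x \<otimes>\<^bsub>U\<^esub> y = scale U c (x \<otimes>\<^bsub>U\<^esub> y)"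
    using X Y by (simp add: cls_mult scale_cls C_scale C_mult mult.assoc del: cls.hom_mult)
  show "x \<otimes>\<^bsub>U\<^esub> scale U c y = scale U c (x \<otimes>\<^bsub>U\<^esub> y)"
  proof -
    have "X i * (scalar c * Y i) = scalar c * (X i * Y i)" for i
      by (metis mult.assoc scalar_commute)
    then show ?thesis using X Y by (simp add: cls_mult scale_cls C_scale C_mult del: cls.hom_mult)
  qed
  show "nrm U (x \<oplus>\<^bsub>U\<^esub> y) \<le> nrm U x + nrm U y" by (rule nrm_U_triangle) fact+
  show "nrm U (x \<otimes>\<^bsub>U\<^esub> y) \<le> nrm U x * nrm U y"
    unfolding X(2) Y(2) cls_mult[OF X(1) Y(1)]
    by (rule lim_le[OF nrm_cls[OF C_mult[OF X(1) Y(1)]] tendsto_mult[OF nrm_cls[OF X(1)] nrm_cls[OF Y(1)]]])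
      (rule N_mult[OF CD[OF X(1)] CD[OF Y(1)]])
qed (rule nrm_U_complete)

theorem univ_cstar_universal:
  assumes B: "unital_cstar_algebra B"
    and \<phi>: "\<And>g. g \<in> G \<Longrightarrow> \<phi> g \<in> carrier B"
    and rel: "\<And>r. r \<in> R \<Longrightarrow> unital_cstar_algebra.poly_eval B \<phi> r = \<zero>\<^bsub>B\<^esub>"
  shows "\<exists>h\<in>cstar_hom U B. (\<forall>g\<in>G. h (univ_gen G R g) = \<phi> g) \<and>
    (\<forall>x\<in>carrier U. nrm B (h x) \<le> nrm U x)"
proof -
  interpret B: unital_cstar_algebra B by (rule B)
  let ?e = "B.poly_eval \<phi>"
  have closed [simp]: "?e f \<in> carrier B" if "f \<in> star_polys G" for f
    by (rule B.poly_eval_closed[of G]) (use \<phi> that in auto)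
  have le: "nrm B (?e f) \<le> N f" if f: "f \<in> star_polys G" for f
    by (rule N_upper[OF _ f]) (use B.poly_eval_seminorm[of G \<phi>] \<phi> rel in auto)
  have minus: "?e (f - g) = ?e f \<ominus>\<^bsub>B\<^esub> ?e g" if "f \<in> star_polys G" "g \<in> star_polys G" for f g
    by (rule B.poly_eval_minus[of G]) (use \<phi> that in auto)
  have ex: "\<exists>b. B.lim_to (\<lambda>i. ?e (X i)) b" if X: "X \<in> carrier C" for X
  proof -
    have "\<exists>b\<in>carrier B. (\<lambda>i. nrm B (?e (X i) \<ominus>\<^bsub>B\<^esub> b)) \<longlonglongrightarrow> 0"
    proof (rule B.complete)
      show "?e (X i) \<in> carrier B" for i using CD[OF X] by simp
      fix e :: real assume "e > 0"
      then obtain K where K: "\<forall>i\<ge>K. \<forall>j\<ge>K. N (X i - X j) < e" using C_cauchy[OF X] by blast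
      have "nrm B (?e (X i) \<ominus>\<^bsub>B\<^esub> ?e (X j)) < e" if "i \<ge> K" "j \<ge> K" for i j
        using le[OF star_polys_diff[OF CD[OF X, of i] CD[OF X, of j]]] K[rule_format, OF that]
        unfolding minus[OF CD[OF X, of i] CD[OF X, of j]] by simp
      then show "\<exists>K. \<forall>i\<ge>K. \<forall>j\<ge>K. nrm B (?e (X i) \<ominus>\<^bsub>B\<^esub> ?e (X j)) < e" by blast
    qed
    then show ?thesis using CD[OF X] by (auto simp: B.lim_to_def)
  qed
  define h where "h x = (SOME b. \<exists>X. X \<in> carrier C \<and> x = cls X \<and> B.lim_to (\<lambda>i. ?e (X i)) b)" for x
  have lim: "B.lim_to (\<lambda>i. ?e (X i)) (h (cls X))" if X: "X \<in> carrier C" for X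
  proof -
    have "\<exists>Y. Y \<in> carrier C \<and> cls X = cls Y \<and> B.lim_to (\<lambda>i. ?e (Y i)) (h (cls X))"
      unfolding h_def by (rule someI_ex) (use ex[OF X] X in blast)
    then obtain Y where Y: "Y \<in> carrier C" and XY: "cls X = cls Y"
      and l: "B.lim_to (\<lambda>i. ?e (Y i)) (h (cls X))" by blast
    have I: "(\<lambda>i. X i - Y i) \<in> I" using cls_eq[OF Y X] XY by simp
    have bc: "h (cls X) \<in> carrier B" by (rule B.lim_toD(2)[OF l])
    show ?thesis
    proof (rule B.lim_toI)
      show "?e (X i) \<in> carrier B" for i using CD[OF X] by simp
      show "nrm B (?e (X i) \<ominus>\<^bsub>B\<^esub> h (cls X)) \<le> N (X i - Y i) + nrm B (?e (Y i) \<ominus>\<^bsub>B\<^esub> h (cls X))" for i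
        using B.nrm_minus_triangle[OF closed[OF CD[OF X]] closed[OF CD[OF Y]] bc, of i i]
          le[OF star_polys_diff[OF CD[OF X, of i] CD[OF Y, of i]]]
        unfolding minus[OF CD[OF X, of i] CD[OF Y, of i]] by linarith
      show "(\<lambda>i. N (X i - Y i) + nrm B (?e (Y i) \<ominus>\<^bsub>B\<^esub> h (cls X))) \<longlonglongrightarrow> 0"
        using tendsto_add[OF ID(2)[OF I] B.lim_toD(3)[OF l]] by simp
    qed (rule bc)
  qed
  have eq: "h (cls X) = b" if "X \<in> carrier C" "B.lim_to (\<lambda>i. ?e (X i)) b" for X b
    using B.lim_to_unique[OF lim] that by blast
  have const: "h (cls (\<lambda>i. f)) = ?e f" if f: "f \<in> star_polys G" for f
    by (rule eq[OF const_in_C[OF f]]) (rule B.lim_to_const[OF closed[OF f]])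
  have "h \<in> cstar_hom U B"
    unfolding cstar_hom_def
  proof (intro CollectI conjI ballI allI ring_hom_memI)
    show "h \<one>\<^bsub>U\<^esub> = \<one>\<^bsub>B\<^esub>"
      unfolding cls_one using const[OF one_in] B.poly_eval_1[of G \<phi>] \<phi> by simp
  next
    fix x assume "x \<in> carrier U"
    then obtain X where X: "X \<in> carrier C" "x = cls X" by (rule U_cases)
    show "h x \<in> carrier B" unfolding X(2) by (rule B.lim_toD(2)[OF lim[OF X(1)]])
    show "h (adj U x) = adj B (h x)"
      unfolding X(2) adj_cls[OF X(1)]
      by (rule eq[OF C_star[OF X(1)]])
        (use B.lim_to_adj[OF lim[OF X(1)]] B.poly_eval_star[of G \<phi>] \<phi> CD[OF X(1)] in simp)
    show "h (scale U c x) = scale B c (h x)" for c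
      unfolding X(2) scale_cls[OF X(1)]
      by (rule eq[OF C_scale[OF X(1)]])
        (use B.lim_to_scale[OF lim[OF X(1)]] B.poly_eval_scale[of G \<phi>] \<phi> CD[OF X(1)] in simp)
    fix y assume "y \<in> carrier U"
    then obtain Y where Y: "Y \<in> carrier C" "y = cls Y" by (rule U_cases)
    show "h (x \<otimes>\<^bsub>U\<^esub> y) = h x \<otimes>\<^bsub>B\<^esub> h y"
      unfolding X(2) Y(2) cls_mult[OF X(1) Y(1)]
      by (rule eq[OF C_mult[OF X(1) Y(1)]])
        (use B.lim_to_mult[OF lim[OF X(1)] lim[OF Y(1)]] B.poly_eval_mult[of G \<phi>] \<phi> CD[OF X(1)] CD[OF Y(1)] in simp)
    show "h (x \<oplus>\<^bsub>U\<^esub> y) = h x \<oplus>\<^bsub>B\<^esub> h y"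
      unfolding X(2) Y(2) cls_add[OF X(1) Y(1)]
      by (rule eq[OF C_add[OF X(1) Y(1)]])
        (use B.lim_to_add[OF lim[OF X(1)] lim[OF Y(1)]] B.poly_eval_add[of G \<phi>] \<phi> CD[OF X(1)] CD[OF Y(1)] in simp)
  qed
  moreover have "h (univ_gen G R g) = \<phi> g" if "g \<in> G" for g
    unfolding univ_gen_def using const[OF gen_in[OF that]] B.poly_eval_gen[of G \<phi>] \<phi> that by simp
  moreover have "nrm B (h x) \<le> nrm U x" if x: "x \<in> carrier U" for x
  proof -
    obtain X where X: "X \<in> carrier C" "x = cls X" by (rule U_cases[OF x])
    show ?thesis unfolding X(2)
      by (rule lim_le[OF B.lim_to_nrm[OF lim[OF X(1)]] nrm_cls[OF X(1)]]) (rule le[OF CD[OF X(1)]])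
  qed
  ultimately show ?thesis by blast
qed

theorem univ_cstar_generated:
  assumes D: "D \<subseteq> carrier U" and one: "\<one>\<^bsub>U\<^esub> \<in> D" and gens: "\<And>g. g \<in> G \<Longrightarrow> univ_gen G R g \<in> D"
    and add: "\<And>x y. x \<in> D \<Longrightarrow> y \<in> D \<Longrightarrow> x \<oplus>\<^bsub>U\<^esub> y \<in> D"
    and mult: "\<And>x y. x \<in> D \<Longrightarrow> y \<in> D \<Longrightarrow> x \<otimes>\<^bsub>U\<^esub> y \<in> D"
    and scale: "\<And>c x. x \<in> D \<Longrightarrow> scale U c x \<in> D" and adj: "\<And>x. x \<in> D \<Longrightarrow> adj U x \<in> D"
    and closed: "\<And>x. x \<in> carrier U \<Longrightarrow> (\<And>e. e > 0 \<Longrightarrow> \<exists>d\<in>D. nrm U (x \<ominus>\<^bsub>U\<^esub> d) < e) \<Longrightarrow> x \<in> D"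
  shows "D = carrier U"
proof -
  have word: "cls (\<lambda>i. Poly_Mapping.single w 1) \<in> D" if "set w \<subseteq> Gen ` G \<union> Adj ` G" for w
    using that
  proof (induction w)
    case Nil
    have "(1 :: 'g star_poly) = Poly_Mapping.single [] 1" by (metis scalar_1 scalar_def)
    then show ?case using one cls_one by simp
  next
    case (Cons l w)
    have l: "l \<in> Gen ` G \<union> Adj ` G" and w: "set w \<subseteq> Gen ` G \<union> Adj ` G" using Cons.prems by auto
    have g: "cls (\<lambda>i. gen g) \<in> D" if "g \<in> G" for g using gens[OF that] by (simp add: univ_gen_def)
    have lD: "cls (\<lambda>i. Poly_Mapping.single [l] 1) \<in> D"
    proof (cases l)
      case (Gen g)
      then show ?thesis using g[of g] l by (auto simp: gen_def)
    next
      case (Adj g)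
      then have gG: "g \<in> G" using l by auto
      have "star (gen g) = Poly_Mapping.single [l] 1" using Adj by (simp add: gen_def star_single)
      then show ?thesis using adj[OF g[OF gG]] adj_cls[OF const_in_C[OF gen_in[OF gG]]] by simp
    qed
    have "Poly_Mapping.single (l # w) (1 :: complex) = Poly_Mapping.single [l] 1 * Poly_Mapping.single w 1"
      by (simp add: mult_single_append)
    then show ?case
      using mult[OF lD Cons.IH[OF w]] l w
      by (subst (asm) cls_mult) (auto intro!: const_in_C star_polys_single)
  qed
  have poly: "cls (\<lambda>i. f) \<in> D" if "f \<in> star_polys G" for f
    using that
  proof (induction rule: star_polys_induct)
    case zero
    have "cls (\<lambda>i. scalar 0 * 1) \<in> D"
      using scale[OF one, of 0] unfolding cls_one scale_cls[OF const_in_C[OF one_in]] .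
    then show ?case by (simp add: scalar_0)
  next
    case (single w c)
    have "scalar c * Poly_Mapping.single w 1 = Poly_Mapping.single w c"
      by (simp add: scalar_def mult_single_append)
    then show ?case
      using scale[OF word[OF single], of c] scale_cls[OF const_in_C[OF star_polys_single[OF single]], of c 1] by simp
  next
    case (add f g)
    then show ?case using assms(4)[OF add(3,4)] cls_add[OF const_in_C const_in_C, of f g] by simp
  qed
  have "x \<in> D" if x: "x \<in> carrier U" for x
  proof (rule closed[OF x])
    fix e :: real assume e: "e > 0"
    obtain X where X: "X \<in> carrier C" "x = cls X" using x by (rule U_cases)
    obtain f where "f \<in> star_polys G" "nrm U (cls X \<ominus>\<^bsub>U\<^esub> cls (\<lambda>i. f)) \<le> e / 2"
      using const_dense[OF X(1), of "e / 2"] e by auto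
    then show "\<exists>d\<in>D. nrm U (x \<ominus>\<^bsub>U\<^esub> d) < e"
      using poly e unfolding X(2) by (intro bexI[of _ "cls (\<lambda>i. f)"]) auto
  qed
  then show ?thesis using D by blast
qed

theorem univ_cstar_relation: "r \<in> R \<Longrightarrow> r \<in> star_polys G \<Longrightarrow> cls (\<lambda>i. r) = \<zero>\<^bsub>U\<^esub>"
proof -
  assume r: "r \<in> R" "r \<in> star_polys G"
  have "(\<lambda>i. r) \<in> I" by (rule II[OF const_in_C[OF r(2)]]) (simp add: N_rel[OF r(1)])
  then show ?thesis
    unfolding cls_zero using cls_eq[OF const_in_C[OF star_polys_0] const_in_C[OF r(2)]] by simp
qed

lemma cls_in_U: "X \<in> carrier C \<Longrightarrow> cls X \<in> carrier U"
  by (rule cls.hom_closed)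

lemma cls_relation:
  assumes "f - g \<in> R" "f \<in> star_polys G" "g \<in> star_polys G" shows "cls (\<lambda>i. f) = cls (\<lambda>i. g)"
proof -
  have "(\<lambda>i. f - g) \<in> I"
    by (rule II[OF const_in_C[OF star_polys_diff[OF assms(2,3)]]]) (simp add: N_rel[OF assms(1)])
  then show ?thesis using cls_eq[OF const_in_C const_in_C] assms by blast
qed


end

lemma isometries_bounded_presentation:
  assumes R: "\<And>g. g \<in> G \<Longrightarrow> star (gen g) * gen g - 1 \<in> R"
  shows "bounded_presentation G R"
proof
  fix f assume "f \<in> star_polys G"
  then show "\<exists>b. \<forall>p. cstar_seminorm G p \<and> (\<forall>r\<in>R. p r = 0) \<longrightarrow> p f \<le> b"
  proof (induction rule: star_polys_induct)
    case zero
    have "p 0 \<le> 0" if p: "cstar_seminorm G p" for p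
      using cstar_seminormD(1)[OF p star_polys_0, of 0] by simp
    then show ?case by blast
  next
    case (single w c)
    have "p (Poly_Mapping.single w c) \<le> cmod c" if p: "cstar_seminorm G p" "\<forall>r\<in>R. p r = 0" for p
    proof -
      have p1: "p 1 \<le> 1"
      proof -
        have "(p 1)\<^sup>2 = p 1" using cstar_seminormD(2)[OF p(1) one_in] by simp
        then show ?thesis by (auto simp: power2_eq_square)
      qed
      have pg: "p (gen g) \<le> 1" if g: "g \<in> G" for g
      proof -
        have "(p (gen g))\<^sup>2 = p (star (gen g) * gen g)"
          using cstar_seminormD(2)[OF p(1) gen_in[OF g]] by simp
        also have "\<dots> = p ((star (gen g) * gen g - 1) + 1)" by simp
        also have "\<dots> \<le> p (star (gen g) * gen g - 1) + p 1"
          using g by (intro cstar_seminormD(3)[OF p(1)]) auto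
        also have "\<dots> \<le> 1" using p(2) R[OF g] p1 by simp
        finally show ?thesis by (simp add: abs_square_le_1 abs_le_iff)
      qed
      have pl: "p (Poly_Mapping.single [l] 1) \<le> 1" if "l \<in> Gen ` G \<union> Adj ` G" for l
      proof (cases l)
        case (Gen g)
        then show ?thesis using pg[of g] that by (auto simp: gen_def)
      next
        case (Adj g)
        then have g: "g \<in> G" using that by auto
        have "Poly_Mapping.single [l] 1 = star (gen g)" using Adj by (simp add: gen_def star_single)
        then show ?thesis
          using cstar_seminorm_star_le[OF p(1), of "star (gen g)"] g pg[OF g] by (simp add: star_star)
      qed
      have pw: "p (Poly_Mapping.single w 1) \<le> 1"
        using single
      proof (induction w)
        case Nil
        have "(1 :: 'a star_poly) = Poly_Mapping.single [] 1" by (metis scalar_1 scalar_def)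
        then show ?case using p1 by simp
      next
        case (Cons l w)
        have l: "l \<in> Gen ` G \<union> Adj ` G" and w: "set w \<subseteq> Gen ` G \<union> Adj ` G" using Cons.prems by auto
        have lP: "Poly_Mapping.single [l] 1 \<in> star_polys G" and wP: "Poly_Mapping.single w 1 \<in> star_polys G"
          using l w by (auto intro: star_polys_single)
        have "p (Poly_Mapping.single (l # w) 1) = p (Poly_Mapping.single [l] 1 * Poly_Mapping.single w 1)"
          by (simp add: mult_single_append)
        also have "\<dots> \<le> p (Poly_Mapping.single [l] 1) * p (Poly_Mapping.single w 1)"
          by (rule cstar_seminormD(4)[OF p(1) lP wP])
        also have "\<dots> \<le> 1 * 1"
          using cstar_seminorm_nonneg[OF p(1) wP] pl[OF l] Cons.IH[OF w] by (intro mult_mono) auto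
        finally show ?case by simp
      qed
      have "Poly_Mapping.single w c = scalar c * Poly_Mapping.single w 1"
        by (simp add: scalar_def mult_single_append)
      then have "p (Poly_Mapping.single w c) = cmod c * p (Poly_Mapping.single w 1)"
        using cstar_seminormD(1)[OF p(1) star_polys_single[OF single], of c 1] by simp
      also have "\<dots> \<le> cmod c * 1" by (intro mult_left_mono pw) simp
      finally show ?thesis by simp
    qed
    then show ?case by blast
  next
    case (add f g)
    then obtain a b where "\<forall>p. cstar_seminorm G p \<and> (\<forall>r\<in>R. p r = 0) \<longrightarrow> p f \<le> a"
      "\<forall>p. cstar_seminorm G p \<and> (\<forall>r\<in>R. p r = 0) \<longrightarrow> p g \<le> b" by blast
    then have "\<forall>p. cstar_seminorm G p \<and> (\<forall>r\<in>R. p r = 0) \<longrightarrow> p (f + g) \<le> a + b"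
      using cstar_seminormD(3)[OF _ add(1,2)] by (smt (verit))
    then show ?case by blast
  qed
qed

lemma E_relators_isometry: "g \<in> E_gens n m \<Longrightarrow> star (gen g) * gen g - 1 \<in> E_relators n m q"
  unfolding E_gens_def
proof (elim UnE imageE)
  fix i assume g: "g = GenS i" and i: "i \<in> {1..n}"
  have "star (gen (GenS i)) * gen (GenS i) - of_bool (i = i) \<in> E_relators n m q"
    unfolding E_relators_def using i by blast
  then show ?thesis by (simp add: g)
next
  fix i assume g: "g = GenT i" and i: "i \<in> {1..m}"
  have "star (gen (GenT i)) * gen (GenT i) - of_bool (i = i) \<in> E_relators n m q"
    unfolding E_relators_def using i by blast
  then show ?thesis by (simp add: g)
qed

subsection \<open>The algebras \<open>\<E>\<^sup>q\<^bsub>n,m\<^esub>\<close>\<close>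

interpretation E: bounded_presentation "E_gens n m" "E_relators n m q" for n m q
  by (rule isometries_bounded_presentation) (rule E_relators_isometry)

theorem E_cstar_unital_cstar_algebra: "unital_cstar_algebra (E_cstar n m q)"
  unfolding E_cstar_def by (rule E.univ_cstar_is_cstar)

theorem E_cstar_family: "E_family n m q (E_cstar n m q) (E_s n m q) (E_t n m q)"
proof -
  note C = E.const_in_C[of _ n m q]
  have S: "gen (GenS i) \<in> star_polys (E_gens n m)" if "i \<in> {1..n}" for i
    using that by (auto simp: E_gens_def)
  have T: "gen (GenT r) \<in> star_polys (E_gens n m)" if "r \<in> {1..m}" for r
    using that by (auto simp: E_gens_def)
  have D: "of_bool b \<in> star_polys (E_gens n m)" for b by (cases b) auto
  have star_mult_eq: "adj (E_cstar n m q) (univ_gen (E_gens n m) (E_relators n m q) a)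
      \<otimes>\<^bsub>E_cstar n m q\<^esub> univ_gen (E_gens n m) (E_relators n m q) b =
      null_ideal (E_gens n m) (E_relators n m q) +>\<^bsub>cauchy_ring (E_gens n m) (E_relators n m q)\<^esub> (\<lambda>i. star (gen a) * gen b)"
    if "gen a \<in> star_polys (E_gens n m)" "gen b \<in> star_polys (E_gens n m)" for a b
    unfolding E_cstar_def univ_gen_def E.adj_cls[OF C[OF that(1)]]
    by (rule E.cls_mult[OF C[OF star_in[OF that(1)]] C[OF that(2)]])
  have delta: "null_ideal (E_gens n m) (E_relators n m q) +>\<^bsub>cauchy_ring (E_gens n m) (E_relators n m q)\<^esub> (\<lambda>i. of_bool b) =
      (if b then \<one>\<^bsub>E_cstar n m q\<^esub> else \<zero>\<^bsub>E_cstar n m q\<^esub>)" for b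
    unfolding E_cstar_def by (simp add: E.cls_one E.cls_zero)
  have "adj (E_cstar n m q) (E_s n m q i) \<otimes>\<^bsub>E_cstar n m q\<^esub> E_s n m q j =
      (if i = j then \<one>\<^bsub>E_cstar n m q\<^esub> else \<zero>\<^bsub>E_cstar n m q\<^esub>)" if "i \<in> {1..n}" "j \<in> {1..n}" for i j
  proof -
    have "star (gen (GenS i)) * gen (GenS j) - of_bool (i = j) \<in> E_relators n m q"
      using that unfolding E_relators_def by blast
    from E.cls_relation[OF this star_polys_mult[OF star_in[OF S] S] D] that
    show ?thesis unfolding E_s_def star_mult_eq[OF S[OF that(1)] S[OF that(2)]] delta by simp
  qed
  moreover have "adj (E_cstar n m q) (E_t n m q i) \<otimes>\<^bsub>E_cstar n m q\<^esub> E_t n m q j =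
      (if i = j then \<one>\<^bsub>E_cstar n m q\<^esub> else \<zero>\<^bsub>E_cstar n m q\<^esub>)" if "i \<in> {1..m}" "j \<in> {1..m}" for i j
  proof -
    have "star (gen (GenT i)) * gen (GenT j) - of_bool (i = j) \<in> E_relators n m q"
      using that unfolding E_relators_def by blast
    from E.cls_relation[OF this star_polys_mult[OF star_in[OF T] T] D] that
    show ?thesis unfolding E_t_def star_mult_eq[OF T[OF that(1)] T[OF that(2)]] delta by simp
  qed
  moreover have "adj (E_cstar n m q) (E_s n m q j) \<otimes>\<^bsub>E_cstar n m q\<^esub> E_t n m q r =
      scale (E_cstar n m q) q (E_t n m q r \<otimes>\<^bsub>E_cstar n m q\<^esub> adj (E_cstar n m q) (E_s n m q j))"
    if j: "j \<in> {1..n}" and r: "r \<in> {1..m}" for j r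
  proof -
    note s = S[OF j] and t = T[OF r]
    have "star (gen (GenS j)) * gen (GenT r) - scalar q * gen (GenT r) * star (gen (GenS j)) \<in> E_relators n m q"
      using j r unfolding E_relators_def by blast
    from E.cls_relation[OF this] s t
    show ?thesis unfolding E_s_def E_t_def star_mult_eq[OF s t]
      unfolding E_cstar_def univ_gen_def E.adj_cls[OF C[OF s]] E.cls_mult[OF C[OF t] C[OF star_in[OF s]]]
        E.scale_cls[OF C[OF star_polys_mult[OF t star_in[OF s]]]] by (simp add: mult.assoc)
  qed
  moreover have "E_s n m q i \<in> carrier (E_cstar n m q)" if "i \<in> {1..n}" for i
    unfolding E_s_def univ_gen_def E_cstar_def by (rule E.cls_in_U[OF C[OF S[OF that]]])
  moreover have "E_t n m q i \<in> carrier (E_cstar n m q)" if "i \<in> {1..m}" for i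
    unfolding E_t_def univ_gen_def E_cstar_def by (rule E.cls_in_U[OF C[OF T[OF that]]])
  ultimately show ?thesis unfolding E_family_def by blast
qed

theorem E_cstar_universal:
  assumes B: "unital_cstar_algebra B" and fam: "E_family n m q B s t"
  shows "\<exists>h\<in>cstar_hom (E_cstar n m q) B.
    (\<forall>i\<in>{1..n}. h (E_s n m q i) = s i) \<and> (\<forall>r\<in>{1..m}. h (E_t n m q r) = t r) \<and>
    (\<forall>x\<in>carrier (E_cstar n m q). nrm B (h x) \<le> nrm (E_cstar n m q) x)"
proof -
  interpret B: unital_cstar_algebra B by (rule B)
  have famD: "\<And>i. i \<in> {1..n} \<Longrightarrow> s i \<in> carrier B" "\<And>r. r \<in> {1..m} \<Longrightarrow> t r \<in> carrier B"
    "\<And>i j. i \<in> {1..n} \<Longrightarrow> j \<in> {1..n} \<Longrightarrow> adj B (s i) \<otimes>\<^bsub>B\<^esub> s j = (if i = j then \<one>\<^bsub>B\<^esub> else \<zero>\<^bsub>B\<^esub>)"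
    "\<And>r l. r \<in> {1..m} \<Longrightarrow> l \<in> {1..m} \<Longrightarrow> adj B (t r) \<otimes>\<^bsub>B\<^esub> t l = (if r = l then \<one>\<^bsub>B\<^esub> else \<zero>\<^bsub>B\<^esub>)"
    "\<And>j r. j \<in> {1..n} \<Longrightarrow> r \<in> {1..m} \<Longrightarrow>
      adj B (s j) \<otimes>\<^bsub>B\<^esub> t r = scale B q (t r \<otimes>\<^bsub>B\<^esub> adj B (s j))"
    using fam unfolding E_family_def by blast+
  define \<phi> where "\<phi> g = (case g of GenS i \<Rightarrow> s i | GenT r \<Rightarrow> t r)" for g
  let ?G = "E_gens n m" and ?e = "B.poly_eval \<phi>"
  have \<phi>: "\<phi> g \<in> carrier B" if "g \<in> ?G" for g
    using that famD(1,2) by (auto simp: \<phi>_def E_gens_def)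
  note ev = B.poly_eval_mult[of ?G \<phi>, OF \<phi>] B.poly_eval_star[of ?G \<phi>, OF \<phi>] B.poly_eval_minus[of ?G \<phi>, OF \<phi>]
    B.poly_eval_scalar[of ?G \<phi>, OF \<phi>] B.poly_eval_gen[of ?G \<phi>, OF \<phi>] B.poly_eval_1[of ?G \<phi>, OF \<phi>]
  have gens: "GenS i \<in> ?G" if "i \<in> {1..n}" for i using that by (simp add: E_gens_def)
  have gent: "GenT r \<in> ?G" if "r \<in> {1..m}" for r using that by (simp add: E_gens_def)
  have D: "of_bool b \<in> star_polys ?G" for b by (cases b) auto
  have eD: "?e (of_bool b) = (if b then \<one>\<^bsub>B\<^esub> else \<zero>\<^bsub>B\<^esub>)" for b
    using ev(6) B.poly_eval_0[of ?G \<phi>, OF \<phi>] by (cases b) simp_all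
  have adj_mult: "?e (star (gen a) * gen b) = adj B (\<phi> a) \<otimes>\<^bsub>B\<^esub> \<phi> b" if "a \<in> ?G" "b \<in> ?G" for a b
    using that by (simp add: ev(1,2,5))
  have "?e r = \<zero>\<^bsub>B\<^esub>" if "r \<in> E_relators n m q" for r
    using that unfolding E_relators_def
  proof (elim UnE CollectE exE conjE)
    fix i j assume r: "r = star (gen (GenS i)) * gen (GenS j) - of_bool (i = j)" and ij: "i \<in> {1..n}" "j \<in> {1..n}"
    have "?e r = adj B (s i) \<otimes>\<^bsub>B\<^esub> s j \<ominus>\<^bsub>B\<^esub> (if i = j then \<one>\<^bsub>B\<^esub> else \<zero>\<^bsub>B\<^esub>)"
      unfolding r using gens[OF ij(1)] gens[OF ij(2)] by (simp only: ev(3) adj_mult D eD star_polys_mult star_in gen_in) (simp add: \<phi>_def)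
    then show ?thesis using famD(3)[OF ij] by (simp add: a_minus_def B.r_neg)
  next
    fix i j assume r: "r = star (gen (GenT i)) * gen (GenT j) - of_bool (i = j)" and ij: "i \<in> {1..m}" "j \<in> {1..m}"
    have "?e r = adj B (t i) \<otimes>\<^bsub>B\<^esub> t j \<ominus>\<^bsub>B\<^esub> (if i = j then \<one>\<^bsub>B\<^esub> else \<zero>\<^bsub>B\<^esub>)"
      unfolding r using gent[OF ij(1)] gent[OF ij(2)] by (simp only: ev(3) adj_mult D eD star_polys_mult star_in gen_in) (simp add: \<phi>_def)
    then show ?thesis using famD(4)[OF ij] by (simp add: a_minus_def B.r_neg)
  next
    fix j k assume r: "r = star (gen (GenS j)) * gen (GenT k) - scalar q * gen (GenT k) * star (gen (GenS j))"
      and jk: "j \<in> {1..n}" "k \<in> {1..m}"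
    note c = famD(1)[OF jk(1)] famD(2)[OF jk(2)]
    have "?e r = adj B (s j) \<otimes>\<^bsub>B\<^esub> t k \<ominus>\<^bsub>B\<^esub> scale B q (t k \<otimes>\<^bsub>B\<^esub> adj B (s j))"
      unfolding r using gens[OF jk(1)] gent[OF jk(2)] c by (simp add: ev \<phi>_def B.scale_mult_left)
    then show ?thesis using famD(5)[OF jk] c by (simp add: a_minus_def B.r_neg)
  qed
  from E.univ_cstar_universal[OF B \<phi> this]
  obtain h where h: "h \<in> cstar_hom (E_cstar n m q) B"
    and hg: "\<forall>g\<in>?G. h (univ_gen ?G (E_relators n m q) g) = \<phi> g"
    and hn: "\<forall>x\<in>carrier (E_cstar n m q). nrm B (h x) \<le> nrm (E_cstar n m q) x"
    unfolding E_cstar_def by blast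
  have "h (E_s n m q i) = s i" if "i \<in> {1..n}" for i
    using hg gens[OF that] by (simp add: E_s_def \<phi>_def)
  moreover have "h (E_t n m q r) = t r" if "r \<in> {1..m}" for r
    using hg gent[OF that] by (simp add: E_t_def \<phi>_def)
  ultimately show ?thesis using h hn by blast
qed

theorem E_cstar_generated:
  fixes n m q
  defines "E \<equiv> E_cstar n m q"
  assumes "D \<subseteq> carrier E" and "\<one>\<^bsub>E\<^esub> \<in> D"
    and s: "\<And>i. i \<in> {1..n} \<Longrightarrow> E_s n m q i \<in> D" and t: "\<And>r. r \<in> {1..m} \<Longrightarrow> E_t n m q r \<in> D"
    and "\<And>x y. x \<in> D \<Longrightarrow> y \<in> D \<Longrightarrow> x \<oplus>\<^bsub>E\<^esub> y \<in> D"
    and "\<And>x y. x \<in> D \<Longrightarrow> y \<in> D \<Longrightarrow> x \<otimes>\<^bsub>E\<^esub> y \<in> D"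
    and "\<And>c x. x \<in> D \<Longrightarrow> scale E c x \<in> D" and "\<And>x. x \<in> D \<Longrightarrow> adj E x \<in> D"
    and "\<And>x. x \<in> carrier E \<Longrightarrow> (\<And>e. e > 0 \<Longrightarrow> \<exists>d\<in>D. nrm E (x \<ominus>\<^bsub>E\<^esub> d) < e) \<Longrightarrow> x \<in> D"
  shows "D = carrier E"
proof -
  have g: "univ_gen (E_gens n m) (E_relators n m q) g \<in> D" if "g \<in> E_gens n m" for g
    using that s t unfolding E_gens_def E_s_def E_t_def by blast
  show ?thesis
    unfolding E_def E_cstar_def
    by (rule E.univ_cstar_generated[OF assms(2,3)[unfolded E_def E_cstar_def] g
      assms(6-)[unfolded E_def E_cstar_def]])
qed

end

theory Submission
  imports Defs
begin

text \<open>
  The isomorphism fixes the isometries \<open>s\<^sub>1, \<dots>, s\<^sub>n\<close> and changes only the \<open>t\<^sub>r\<close>. All of it is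
  governed by the *-endomorphism \<open>\<Phi> x = \<Sum>\<^sub>j s\<^sub>j x s\<^sub>j\<^sup>*\<close>, whose value \<open>P = \<Phi> 1\<close> is the projection onto
  the joint range of the \<open>s\<^sub>j\<close>, and by the elements \<open>W \<nu> = (1 - P) + \<nu> P\<close>.

  Since \<open>P = \<Sum>\<^sub>j s\<^sub>j s\<^sub>j\<^sup>*\<close>, the relations \<open>s\<^sub>j\<^sup>* x = q x s\<^sub>j\<^sup>*\<close> for all \<open>j\<close> say exactly that \<open>P x = q \<Phi> x\<close>, that
  is, \<open>x = W 0 x + q \<Phi> x\<close> (lemma \<open>twisted_commutation_iff\<close>). Thus such an \<open>x\<close> is determined by its part
  \<open>a = W 0 x\<close> outside the range of the \<open>s\<^sub>j\<close>: as \<open>\<Phi>\<close> does not increase the norm, \<open>x \<mapsto> a + q \<Phi> x\<close> is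
  a contraction, and \<open>x\<close> is its fixed point. Conversely each \<open>a\<close> with \<open>W 0 a = a\<close> arises in this way.

  For two such elements \<open>x\<close> and \<open>y\<close>, the cross terms of \<open>x\<^sup>* y\<close> vanish, so
  \<open>x\<^sup>* y = (W 0 x)\<^sup>* (W 0 y) + \<bar>q\<bar>\<^sup>2 \<Phi> (x\<^sup>* y)\<close>. Hence the \<open>t\<^sub>r\<close> are orthonormal,
  \<open>t\<^sub>r\<^sup>* t\<^sub>l = \<delta>\<^sub>r\<^sub>l\<close>, if and only if their parts \<open>a\<^sub>r\<close> satisfy \<open>a\<^sub>r\<^sup>* a\<^sub>l = \<delta>\<^sub>r\<^sub>l (1 - \<bar>q\<bar>\<^sup>2 P)\<close>. The last
  factor is \<open>W \<sigma>\<^sup>2\<close> with \<open>\<sigma> = \<surd>(1 - \<bar>q\<bar>\<^sup>2)\<close>, which is nonzero because \<open>\<bar>q\<bar> < 1\<close>. So \<open>a\<^sub>r W (1/\<sigma>)\<close> are isometries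
  with orthogonal ranges, and \<open>W 0 a\<^sub>r = a\<^sub>r\<close> makes these ranges orthogonal to those of the \<open>s\<^sub>j\<close>: together with
  the \<open>s\<^sub>j\<close> they satisfy the relations for \<open>q = 0\<close>. In the other direction, a family for \<open>q = 0\<close> gives
  one for \<open>q\<close> by solving \<open>x = t\<^sub>r W \<sigma> + q \<Phi> x\<close>.

  By universality both constructions define *-homomorphisms. They are inverse to each other on
  generators, the only point to check being that homomorphisms carry fixed points to fixed points, which
  are unique.
\<close>

section \<open>Finite sums, homomorphisms and the normalising constant\<close>

context unital_cstar_algebra
begin

lemma adj_finsum:
  "finite J \<Longrightarrow> f \<in> J \<rightarrow> carrier A \<Longrightarrow> adj A (\<Oplus>j\<in>J. f j) = (\<Oplus>j\<in>J. adj A (f j))"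
  by (induction J rule: finite_induct) (auto simp: Pi_iff adj_add)

lemma scale_finsum:
  "finite J \<Longrightarrow> f \<in> J \<rightarrow> carrier A \<Longrightarrow> scale A c (\<Oplus>j\<in>J. f j) = (\<Oplus>j\<in>J. scale A c (f j))"
  by (induction J rule: finite_induct) (auto simp: Pi_iff scale_add)

lemma nrm_finsum:
  assumes "finite J" and "f \<in> J \<rightarrow> carrier A"
  shows "nrm A (\<Oplus>j\<in>J. f j) \<le> (\<Sum>j\<in>J. nrm A (f j))"
  using assms
proof (induction J rule: finite_induct)
  case (insert j J)
  then have "nrm A (f j \<oplus> (\<Oplus>j\<in>J. f j)) \<le> nrm A (f j) + nrm A (\<Oplus>j\<in>J. f j)"
    by (intro nrm_triangle) (auto simp: Pi_iff)
  with insert show ?case by (auto simp: Pi_iff)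
qed simp

end

lemma cstar_homD:
  assumes "h \<in> cstar_hom A B"
  shows "x \<in> carrier A \<Longrightarrow> h x \<in> carrier B"
    and "x \<in> carrier A \<Longrightarrow> y \<in> carrier A \<Longrightarrow> h (x \<oplus>\<^bsub>A\<^esub> y) = h x \<oplus>\<^bsub>B\<^esub> h y"
    and "x \<in> carrier A \<Longrightarrow> y \<in> carrier A \<Longrightarrow> h (x \<otimes>\<^bsub>A\<^esub> y) = h x \<otimes>\<^bsub>B\<^esub> h y"
    and "h \<one>\<^bsub>A\<^esub> = \<one>\<^bsub>B\<^esub>"
    and "x \<in> carrier A \<Longrightarrow> h (scale A c x) = scale B c (h x)"
    and "x \<in> carrier A \<Longrightarrow> h (adj A x) = adj B (h x)"
  using assms unfolding cstar_hom_def
  by (auto simp: ring_hom_closed ring_hom_add ring_hom_mult ring_hom_one)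

lemma cstar_hom_compose: "f \<in> cstar_hom A B \<Longrightarrow> g \<in> cstar_hom B C \<Longrightarrow> g \<circ> f \<in> cstar_hom A C"
  unfolding cstar_hom_def by (auto intro: ring_hom_trans simp: ring_hom_closed)

lemma cstar_hom_finsum:
  assumes A: "unital_cstar_algebra A" and B: "unital_cstar_algebra B" and h: "h \<in> cstar_hom A B"
    and "finite J" and "f \<in> J \<rightarrow> carrier A"
  shows "h (\<Oplus>\<^bsub>A\<^esub>j\<in>J. f j) = (\<Oplus>\<^bsub>B\<^esub>j\<in>J. h (f j))"
proof -
  interpret A: unital_cstar_algebra A by (rule A)
  interpret B: unital_cstar_algebra B by (rule B)
  have "h \<in> ring_hom A B" using h by (simp add: cstar_hom_def)
  then have "h \<zero>\<^bsub>A\<^esub> = \<zero>\<^bsub>B\<^esub>" by (rule ring_hom_zero) unfold_locales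
  from \<open>finite J\<close> \<open>f \<in> J \<rightarrow> carrier A\<close> this show ?thesis
  proof (induction J rule: finite_induct)
    case (insert j J)
    then show ?case by (simp add: Pi_iff cstar_homD[OF h])
  qed simp
qed

lemma cstar_isomorphicI:
  assumes "f \<in> cstar_hom A B" and "g \<in> cstar_hom B A"
    and "\<And>x. x \<in> carrier A \<Longrightarrow> g (f x) = x" and "\<And>y. y \<in> carrier B \<Longrightarrow> f (g y) = y"
  shows "cstar_isomorphic A B"
  unfolding cstar_isomorphic_def
proof (rule bexI[OF _ assms(1)], rule bij_betwI)
  show "f \<in> carrier A \<rightarrow> carrier B" "g \<in> carrier B \<rightarrow> carrier A"
    using cstar_homD(1)[OF assms(1)] cstar_homD(1)[OF assms(2)] by auto
qed (rule assms(3,4), assumption)+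

text \<open>For an isometry \<open>x\<close> subject to \<open>s\<^sub>j\<^sup>* x = c x s\<^sub>j\<^sup>*\<close>, the element \<open>(W 0 x)\<^sup>* (W 0 x)\<close> acts on the range of
  \<open>\<Phi> 1\<close> as multiplication by \<open>\<sigma>\<^sup>2\<close>.\<close>

lemma defect_root:
  assumes "cmod c < 1" and "\<sigma> = complex_of_real (sqrt (1 - (cmod c)\<^sup>2))"
  shows "\<sigma> \<noteq> 0" and "\<sigma> * \<sigma> = 1 - of_real ((cmod c)\<^sup>2)" and "cnj \<sigma> = \<sigma>"
proof -
  have "(cmod c)\<^sup>2 < 1" using assms(1) by (simp add: power_less_one_iff)
  then have "0 < sqrt (1 - (cmod c)\<^sup>2)" and "sqrt (1 - (cmod c)\<^sup>2) * sqrt (1 - (cmod c)\<^sup>2) = 1 - (cmod c)\<^sup>2"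
    by simp_all
  then show "\<sigma> \<noteq> 0" and "\<sigma> * \<sigma> = 1 - of_real ((cmod c)\<^sup>2)" and "cnj \<sigma> = \<sigma>"
    unfolding assms(2) by (simp_all only: flip: of_real_mult) auto
qed

section \<open>The endomorphism of a finite family of isometries\<close>

locale orthogonal_isometries = unital_cstar_algebra A
  for A :: "('a, 'e) cstar_algebra_scheme" (structure) +
  fixes I :: "'i set" and s :: "'i \<Rightarrow> 'a"
  assumes finite_I [simp]: "finite I"
    and s_closed [simp]: "i \<in> I \<Longrightarrow> s i \<in> carrier A"
    and adj_s_s: "i \<in> I \<Longrightarrow> j \<in> I \<Longrightarrow> adj A (s i) \<otimes> s j = (if i = j then \<one> else \<zero>)"
begin

definition \<Phi> :: "'a \<Rightarrow> 'a" where
  "\<Phi> x = (\<Oplus>j\<in>I. s j \<otimes> x \<otimes> adj A (s j))"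

lemma \<Phi>_closed [simp]: "x \<in> carrier A \<Longrightarrow> \<Phi> x \<in> carrier A"
  unfolding \<Phi>_def by (auto intro!: finsum_closed)

lemma \<Phi>_add:
  assumes x: "x \<in> carrier A" and y: "y \<in> carrier A"
  shows "\<Phi> (x \<oplus> y) = \<Phi> x \<oplus> \<Phi> y"
proof -
  have "\<Phi> (x \<oplus> y) = (\<Oplus>j\<in>I. s j \<otimes> x \<otimes> adj A (s j) \<oplus> s j \<otimes> y \<otimes> adj A (s j))"
    unfolding \<Phi>_def using x y by (intro finsum_cong') (auto simp: r_distr l_distr)
  also have "\<dots> = \<Phi> x \<oplus> \<Phi> y"
    unfolding \<Phi>_def using x y by (intro finsum_addf) auto
  finally show ?thesis .
qed

lemma \<Phi>_scale: "x \<in> carrier A \<Longrightarrow> \<Phi> (scale A c x) = scale A c (\<Phi> x)"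
  unfolding \<Phi>_def
  by (subst scale_finsum) (auto intro!: finsum_cong' simp: scale_mult_left scale_mult_right)

lemma \<Phi>_adj: "x \<in> carrier A \<Longrightarrow> \<Phi> (adj A x) = adj A (\<Phi> x)"
  unfolding \<Phi>_def
  by (subst adj_finsum) (auto intro!: finsum_cong' simp: adj_mult adj_adj m_assoc)

lemma \<Phi>_minus: "x \<in> carrier A \<Longrightarrow> y \<in> carrier A \<Longrightarrow> \<Phi> (x \<ominus> y) = \<Phi> x \<ominus> \<Phi> y"
  unfolding a_minus_def by (simp add: \<Phi>_add \<Phi>_scale flip: scale_uminus)

lemma adj_s_\<Phi>:
  assumes k: "k \<in> I" and x: "x \<in> carrier A"
  shows "adj A (s k) \<otimes> \<Phi> x = x \<otimes> adj A (s k)"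
proof -
  have "adj A (s k) \<otimes> \<Phi> x = (\<Oplus>j\<in>I. adj A (s k) \<otimes> (s j \<otimes> x \<otimes> adj A (s j)))"
    unfolding \<Phi>_def using k x by (intro finsum_rdistr) auto
  also have "\<dots> = (\<Oplus>j\<in>I. if k = j then x \<otimes> adj A (s j) else \<zero>)"
    using k x by (intro finsum_cong') (auto simp: adj_s_s simp flip: m_assoc)
  also have "\<dots> = x \<otimes> adj A (s k)"
    using k x by (intro add.finprod_singleton) auto
  finally show ?thesis .
qed

lemma \<Phi>_mult:
  assumes x: "x \<in> carrier A" and y: "y \<in> carrier A"
  shows "\<Phi> (x \<otimes> y) = \<Phi> x \<otimes> \<Phi> y"
proof -
  have "\<Phi> x \<otimes> \<Phi> y = (\<Oplus>j\<in>I. s j \<otimes> x \<otimes> adj A (s j) \<otimes> \<Phi> y)"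
    unfolding \<Phi>_def[of x] using x y by (intro finsum_ldistr) auto
  also have "\<dots> = \<Phi> (x \<otimes> y)"
    unfolding \<Phi>_def[of "x \<otimes> y"] using x y
    by (intro finsum_cong') (auto simp: adj_s_\<Phi> m_assoc)
  finally show ?thesis ..
qed

text \<open>The triangle inequality bounds \<open>\<Phi>\<close> by some constant \<open>C\<close>, too weak for a contraction. But
  \<open>\<Phi>\<close> is multiplicative, so the C*-identity turns a bound by \<open>C\<close> into a bound by \<open>\<surd>C\<close>, and iterating
  this lowers the constant to 1.\<close>

lemma nrm_\<Phi>:
  assumes "x \<in> carrier A"
  shows "nrm A (\<Phi> x) \<le> nrm A x"
proof (rule ccontr)
  define C where "C = (\<Sum>j\<in>I. nrm A (s j) * nrm A (adj A (s j)))"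
  \<comment> \<open>Taking \<open>2\<^sup>k\<close>-th roots leaves the constant \<open>C\<close> to the power \<open>1 / 2\<^sup>k\<close>.\<close>
  have power: "nrm A (\<Phi> y) ^ 2 ^ k \<le> C * nrm A y ^ 2 ^ k" if "y \<in> carrier A" for y k
    using that
  proof (induction k arbitrary: y)
    case 0
    have "nrm A (s j \<otimes> y \<otimes> adj A (s j)) \<le> nrm A (s j) * nrm A (adj A (s j)) * nrm A y"
      if j: "j \<in> I" for j
    proof -
      have "nrm A (s j \<otimes> y \<otimes> adj A (s j)) \<le> nrm A (s j \<otimes> y) * nrm A (adj A (s j))"
        using j 0 by (intro nrm_mult) auto
      also have "\<dots> \<le> nrm A (s j) * nrm A y * nrm A (adj A (s j))"
        using j 0 by (intro mult_right_mono nrm_mult) (auto simp: nrm_nonneg)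
      finally show ?thesis by (simp add: mult.commute mult.left_commute)
    qed
    then have "(\<Sum>j\<in>I. nrm A (s j \<otimes> y \<otimes> adj A (s j))) \<le> C * nrm A y"
      unfolding C_def sum_distrib_right by (intro sum_mono)
    moreover have "nrm A (\<Phi> y) \<le> (\<Sum>j\<in>I. nrm A (s j \<otimes> y \<otimes> adj A (s j)))"
      unfolding \<Phi>_def using 0 by (intro nrm_finsum) auto
    ultimately show ?case by simp
  next
    case (Suc k)
    have "nrm A (\<Phi> y) ^ 2 ^ Suc k = nrm A (\<Phi> (adj A y \<otimes> y)) ^ 2 ^ k"
      using Suc.prems by (simp add: \<Phi>_mult \<Phi>_adj nrm_adj_mult power_mult)
    also have "\<dots> \<le> C * nrm A (adj A y \<otimes> y) ^ 2 ^ k"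
      using Suc.prems by (intro Suc.IH) auto
    also have "\<dots> = C * nrm A y ^ 2 ^ Suc k"
      using Suc.prems by (simp add: nrm_adj_mult power_mult)
    finally show ?case .
  qed
  assume "\<not> nrm A (\<Phi> x) \<le> nrm A x"
  then have less: "nrm A x < nrm A (\<Phi> x)" by simp
  have pos: "0 < nrm A x"
    using power[OF assms, of 0] less nrm_nonneg[OF assms] by (cases "nrm A x = 0") auto
  obtain k where k: "C < (nrm A (\<Phi> x) / nrm A x) ^ k"
    using real_arch_pow[of "nrm A (\<Phi> x) / nrm A x"] less pos by auto
  have "(nrm A (\<Phi> x) / nrm A x) ^ k \<le> (nrm A (\<Phi> x) / nrm A x) ^ 2 ^ k"
    using less pos by (intro power_increasing) (auto simp: less_imp_le)
  with k have "C < (nrm A (\<Phi> x) / nrm A x) ^ 2 ^ k" by simp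
  with power[OF assms, of k] pos show False by (simp add: power_divide field_simps)
qed

section \<open>Scaling the range corner\<close>

text \<open>This is \<open>(1 - P) + \<nu> P\<close> for the range projection \<open>P = \<Phi> 1\<close>; in particular \<open>W 0\<close> is the complementary
  projection \<open>1 - P\<close>, and \<open>\<nu> \<mapsto> W \<nu>\<close> is multiplicative.\<close>

definition W :: "complex \<Rightarrow> 'a" where
  "W \<nu> = \<one> \<oplus> scale A (\<nu> - 1) (\<Phi> \<one>)"

lemma W_closed [simp]: "W \<nu> \<in> carrier A"
  by (simp add: W_def)

lemma W_1 [simp]: "W 1 = \<one>"
  by (simp add: W_def)

lemma adj_W: "adj A (W \<nu>) = W (cnj \<nu>)"
  by (simp add: W_def adj_add adj_scale flip: \<Phi>_adj)

lemma W_\<Phi>: "x \<in> carrier A \<Longrightarrow> W \<nu> \<otimes> \<Phi> x = scale A \<nu> (\<Phi> x)"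
  using add_scale[of "\<Phi> x" 1 "\<nu> - 1"]
  by (simp add: W_def l_distr scale_mult_left scale_1 flip: \<Phi>_mult)

lemma \<Phi>_W: "x \<in> carrier A \<Longrightarrow> \<Phi> x \<otimes> W \<nu> = scale A \<nu> (\<Phi> x)"
  using add_scale[of "\<Phi> x" 1 "\<nu> - 1"]
  by (simp add: W_def r_distr scale_mult_right scale_1 flip: \<Phi>_mult)

lemma W_mult: "W \<nu> \<otimes> W \<mu> = W (\<nu> * \<mu>)"
proof -
  have "W \<nu> \<otimes> W \<mu> = W \<nu> \<oplus> scale A ((\<mu> - 1) * \<nu>) (\<Phi> \<one>)"
    by (subst (2) W_def) (simp add: r_distr scale_mult_right W_\<Phi> scale_scale)
  also have "\<dots> = \<one> \<oplus> scale A ((\<nu> - 1) + (\<mu> - 1) * \<nu>) (\<Phi> \<one>)"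
    by (simp only: W_def add_scale \<Phi>_closed one_closed scale_closed a_assoc)
  also have "(\<nu> - 1) + (\<mu> - 1) * \<nu> = \<nu> * \<mu> - 1" by (simp add: algebra_simps)
  finally show ?thesis by (simp add: W_def)
qed

lemma adj_s_W: "k \<in> I \<Longrightarrow> adj A (s k) \<otimes> W \<nu> = scale A \<nu> (adj A (s k))"
  using add_scale[of "adj A (s k)" 1 "\<nu> - 1"]
  by (simp add: W_def r_distr scale_mult_right adj_s_\<Phi> scale_1)

lemma W_0_absorb: "x \<in> carrier A \<Longrightarrow> W 0 \<otimes> (W 0 \<otimes> x) = W 0 \<otimes> x"
  by (simp add: W_mult flip: m_assoc)


section \<open>Twisted commutation as a fixed point equation\<close>

text \<open>Multiplying the commutation relations by \<open>s\<^sub>k\<close> from the left and adding up gives \<open>P x = c \<Phi> x\<close>;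
  conversely \<open>s\<^sub>k\<^sup>*\<close> kills \<open>W 0 x\<close> and takes \<open>\<Phi> x\<close> to \<open>x s\<^sub>k\<^sup>*\<close>.\<close>

lemma twisted_commutation_iff:
  assumes x: "x \<in> carrier A"
  shows "(\<forall>k\<in>I. adj A (s k) \<otimes> x = scale A c (x \<otimes> adj A (s k))) \<longleftrightarrow>
    x = W 0 \<otimes> x \<oplus> scale A c (\<Phi> x)"
proof
  assume tc: "\<forall>k\<in>I. adj A (s k) \<otimes> x = scale A c (x \<otimes> adj A (s k))"
  have "\<Phi> \<one> \<otimes> x = (\<Oplus>j\<in>I. s j \<otimes> \<one> \<otimes> adj A (s j) \<otimes> x)"
    unfolding \<Phi>_def using x by (intro finsum_ldistr) auto
  also have "\<dots> = (\<Oplus>j\<in>I. scale A c (s j \<otimes> x \<otimes> adj A (s j)))"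
    using x by (intro finsum_cong') (auto simp: m_assoc tc scale_mult_right)
  also have "\<dots> = scale A c (\<Phi> x)"
    unfolding \<Phi>_def using x by (subst scale_finsum) auto
  finally have "\<Phi> \<one> \<otimes> x = scale A c (\<Phi> x)" .
  moreover have "x = W 0 \<otimes> x \<oplus> \<Phi> \<one> \<otimes> x"
    using x by (simp add: W_def l_distr scale_mult_left scale_uminus a_assoc l_minus l_neg)
  ultimately show "x = W 0 \<otimes> x \<oplus> scale A c (\<Phi> x)" by simp
next
  assume fp: "x = W 0 \<otimes> x \<oplus> scale A c (\<Phi> x)"
  show "\<forall>k\<in>I. adj A (s k) \<otimes> x = scale A c (x \<otimes> adj A (s k))"
  proof
    fix k assume k: "k \<in> I"
    have "adj A (s k) \<otimes> (W 0 \<otimes> x \<oplus> scale A c (\<Phi> x)) = scale A c (x \<otimes> adj A (s k))"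
      using k x
      by (simp add: r_distr scale_mult_right adj_s_\<Phi> adj_s_W flip: m_assoc)
    then show "adj A (s k) \<otimes> x = scale A c (x \<otimes> adj A (s k))" by (simp only: fp[symmetric])
  qed
qed

lemma W_0_fixed_point:
  assumes "x \<in> carrier A" and "a \<in> carrier A" and "x = a \<oplus> scale A c (\<Phi> x)" and "W 0 \<otimes> a = a"
  shows "W 0 \<otimes> x = a"
proof -
  have "W 0 \<otimes> x = W 0 \<otimes> (a \<oplus> scale A c (\<Phi> x))"
    by (simp only: assms(3)[symmetric])
  also have "\<dots> = a"
    using assms(1,2,4) by (simp add: r_distr scale_mult_right W_\<Phi>)
  finally show ?thesis .
qed

text \<open>The ranges of \<open>W 0\<close> and of \<open>\<Phi> 1\<close> are orthogonal, which removes the mixed products.\<close>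

lemma adj_mult_fixed_point:
  assumes x: "x \<in> carrier A" "x = W 0 \<otimes> x \<oplus> scale A c (\<Phi> x)"
    and y: "y \<in> carrier A" "y = W 0 \<otimes> y \<oplus> scale A c (\<Phi> y)"
  shows "adj A x \<otimes> y =
    adj A (W 0 \<otimes> x) \<otimes> (W 0 \<otimes> y) \<oplus> scale A (of_real ((cmod c)\<^sup>2)) (\<Phi> (adj A x \<otimes> y))"
proof -
  define a b where "a = W 0 \<otimes> x" and "b = W 0 \<otimes> y"
  have ab [simp]: "a \<in> carrier A" "b \<in> carrier A" and "W 0 \<otimes> a = a" and b: "W 0 \<otimes> b = b"
    using x y by (simp_all add: a_def b_def W_0_absorb)
  then have a: "adj A a \<otimes> W 0 = adj A a"
    using adj_mult[of "W 0" a] by (simp add: adj_W)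
  have ay: "adj A a \<otimes> \<Phi> y = \<zero>"
    using arg_cong[OF W_\<Phi>[OF y(1), of 0], of "(\<otimes>) (adj A a)"] y(1)
    by (simp add: a flip: m_assoc)
  have xb: "adj A (\<Phi> x) \<otimes> b = \<zero>"
    using arg_cong[OF \<Phi>_W[OF adj_closed[OF x(1)], of 0], of "\<lambda>z. z \<otimes> b"] x(1)
    by (simp add: b m_assoc \<Phi>_adj)
  have "adj A x \<otimes> y = adj A (a \<oplus> scale A c (\<Phi> x)) \<otimes> (b \<oplus> scale A c (\<Phi> y))"
    unfolding a_def b_def by (simp only: x(2)[symmetric] y(2)[symmetric])
  also have "\<dots> = adj A a \<otimes> b \<oplus> scale A (cnj c * c) (\<Phi> (adj A x \<otimes> y))"
    using x(1) y(1)
    by (simp add: adj_add adj_scale l_distr r_distr scale_mult_left scale_mult_right scale_scale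
        ay xb \<Phi>_mult \<Phi>_adj mult.commute)
  also have "cnj c * c = of_real ((cmod c)\<^sup>2)"
    by (simp only: complex_norm_square mult.commute)
  finally show ?thesis by (simp add: a_def b_def)
qed

lemma fixed_point_unique:
  assumes "cmod c < 1" and x: "x \<in> carrier A" and y: "y \<in> carrier A" and a: "a \<in> carrier A"
    and fx: "x = a \<oplus> scale A c (\<Phi> x)" and fy: "y = a \<oplus> scale A c (\<Phi> y)"
  shows "x = y"
proof -
  have "x \<ominus> y = (a \<oplus> scale A c (\<Phi> x)) \<ominus> (a \<oplus> scale A c (\<Phi> y))"
    by (simp only: fx[symmetric] fy[symmetric])
  also have "\<dots> = scale A c (\<Phi> x) \<ominus> scale A c (\<Phi> y)"
    using x y a by (simp add: a_minus_def minus_add a_ac r_neg1 r_neg2)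
  also have "\<dots> = scale A c (\<Phi> (x \<ominus> y))"
    using x y by (simp add: scale_minus \<Phi>_minus)
  finally have "nrm A (x \<ominus> y) = cmod c * nrm A (\<Phi> (x \<ominus> y))"
    using nrm_scale[of "\<Phi> (x \<ominus> y)" c] x y by simp
  also have "\<dots> \<le> cmod c * nrm A (x \<ominus> y)"
    using nrm_\<Phi>[of "x \<ominus> y"] x y by (intro mult_left_mono) auto
  finally have "(1 - cmod c) * nrm A (x \<ominus> y) \<le> 0" by (simp add: algebra_simps)
  then have "nrm A (x \<ominus> y) = 0"
    using assms(1) nrm_nonneg[of "x \<ominus> y"] x y by (simp add: mult_le_0_iff)
  then show ?thesis using x y by (simp add: nrm_eq_0 minus_eq_zero)
qed

text \<open>Picard iteration from \<open>0\<close>. The estimate \<open>tail\<close> below is the usual geometric bound, multiplied by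
  \<open>1 - \<bar>c\<bar>\<close> to avoid division.\<close>

lemma fixed_point_exists:
  assumes c: "cmod c < 1" and a: "a \<in> carrier A"
  shows "\<exists>x\<in>carrier A. x = a \<oplus> scale A c (\<Phi> x)"
proof -
  define X where "X k = ((\<lambda>x. a \<oplus> scale A c (\<Phi> x)) ^^ k) \<zero>" for k
  have X_Suc: "X (Suc k) = a \<oplus> scale A c (\<Phi> (X k))" for k by (simp add: X_def)
  have X [simp]: "X k \<in> carrier A" for k
    by (induction k) (use a in \<open>auto simp: X_Suc\<close>, simp add: X_def)
  have diff: "nrm A (X (Suc k) \<ominus> X (Suc l)) \<le> cmod c * nrm A (X k \<ominus> X l)" for k l
  proof -
    have "X (Suc k) \<ominus> X (Suc l) = scale A c (\<Phi> (X k)) \<ominus> scale A c (\<Phi> (X l))"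
      using a by (simp add: X_Suc a_minus_def minus_add a_ac r_neg1 r_neg2)
    also have "\<dots> = scale A c (\<Phi> (X k \<ominus> X l))" by (simp add: scale_minus \<Phi>_minus)
    finally show ?thesis
      using nrm_\<Phi>[of "X k \<ominus> X l"] by (simp add: nrm_scale mult_left_mono)
  qed
  have tail: "(1 - cmod c) * nrm A (X (l + k) \<ominus> X l) \<le> cmod c ^ l * nrm A a" for k l
  proof (induction l arbitrary: k)
    case 0
    have X0: "X 0 = \<zero>" by (simp add: X_def)
    show ?case
    proof (cases k)
      case 0
      then show ?thesis using a by (simp add: X0 a_minus_def nrm_nonneg)
    next
      case (Suc j)
      have bound: "(1 - cmod c) * nrm A (X j) \<le> nrm A a" for j
      proof (induction j)
        case 0
        then show ?case using a by (simp add: X0 nrm_nonneg)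
      next
        case (Suc j)
        have "nrm A (X (Suc j)) \<le> nrm A a + nrm A (scale A c (\<Phi> (X j)))"
          unfolding X_Suc using a by (intro nrm_triangle) auto
        also have "\<dots> \<le> nrm A a + cmod c * nrm A (X j)"
          using nrm_\<Phi>[of "X j"] by (simp add: nrm_scale mult_left_mono)
        finally have "(1 - cmod c) * nrm A (X (Suc j)) \<le>
            (1 - cmod c) * (nrm A a + cmod c * nrm A (X j))"
          using c by (intro mult_left_mono) auto
        also have "\<dots> = (1 - cmod c) * nrm A a + cmod c * ((1 - cmod c) * nrm A (X j))"
          by (simp add: algebra_simps)
        also have "\<dots> \<le> (1 - cmod c) * nrm A a + cmod c * nrm A a"
          using Suc.IH by (intro add_left_mono mult_left_mono) auto
        finally show ?case by (simp add: algebra_simps)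
      qed
      then show ?thesis by (simp add: X0 a_minus_def)
    qed
  next
    case (Suc l)
    have "(1 - cmod c) * nrm A (X (Suc l + k) \<ominus> X (Suc l)) \<le>
        (1 - cmod c) * (cmod c * nrm A (X (l + k) \<ominus> X l))"
      using diff[of "l + k" l] c by (intro mult_left_mono) auto
    also have "\<dots> = cmod c * ((1 - cmod c) * nrm A (X (l + k) \<ominus> X l))" by simp
    also have "\<dots> \<le> cmod c * (cmod c ^ l * nrm A a)"
      using Suc.IH by (intro mult_left_mono) auto
    finally show ?case by simp
  qed
  have cauchy: "\<exists>K. \<forall>i\<ge>K. \<forall>j\<ge>K. nrm A (X i \<ominus> X j) < e" if e: "e > 0" for e
  proof -
    have "(\<lambda>l. cmod c ^ l * nrm A a) \<longlonglongrightarrow> 0 * nrm A a"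
      using c by (intro tendsto_mult LIMSEQ_power_zero tendsto_const) auto
    moreover have "0 * nrm A a < (1 - cmod c) * e" using c e by simp
    ultimately have "eventually (\<lambda>l. cmod c ^ l * nrm A a < (1 - cmod c) * e) sequentially"
      by (rule order_tendstoD(2))
    then obtain K where K: "\<And>l. l \<ge> K \<Longrightarrow> cmod c ^ l * nrm A a < (1 - cmod c) * e"
      by (auto simp: eventually_sequentially)
    have *: "nrm A (X i \<ominus> X j) < e" if "j \<ge> K" "j \<le> i" for i j
    proof -
      have "(1 - cmod c) * nrm A (X i \<ominus> X j) < (1 - cmod c) * e"
        using tail[of j "i - j"] K[OF that(1)] that(2) by simp
      with c show ?thesis by simp
    qed
    have "nrm A (X i \<ominus> X j) < e" if "i \<ge> K" "j \<ge> K" for i j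
      using *[of i j] *[of j i] that nrm_minus_commute[of "X i" "X j"] by (cases "j \<le> i") auto
    then show ?thesis by blast
  qed
  from complete[of X, OF X cauchy] obtain x where x: "x \<in> carrier A"
    and lim: "(\<lambda>i. nrm A (X i \<ominus> x)) \<longlonglongrightarrow> 0" by blast
  have "lim_to (\<lambda>k. X (Suc k)) x"
    using x LIMSEQ_Suc[OF lim] by (simp add: lim_to_def)
  moreover have "lim_to (\<lambda>k. \<Phi> (X k)) (\<Phi> x)"
  proof (rule lim_toI[OF _ _ _ lim])
    show "nrm A (\<Phi> (X k) \<ominus> \<Phi> x) \<le> nrm A (X k \<ominus> x)" for k
      using nrm_\<Phi>[of "X k \<ominus> x"] x by (simp add: \<Phi>_minus)
  qed (use x in auto)
  then have "lim_to (\<lambda>k. X (Suc k)) (a \<oplus> scale A c (\<Phi> x))"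
    unfolding X_Suc by (intro lim_to_add lim_to_const lim_to_scale a)
  ultimately have "x = a \<oplus> scale A c (\<Phi> x)" by (rule lim_to_unique)
  then show ?thesis using x by (rule bexI)
qed

definition fixpt :: "complex \<Rightarrow> 'a \<Rightarrow> 'a" where
  "fixpt c a = (SOME x. x \<in> carrier A \<and> x = a \<oplus> scale A c (\<Phi> x))"

lemma fixpt:
  assumes "cmod c < 1" and "a \<in> carrier A"
  shows "fixpt c a \<in> carrier A" and "fixpt c a = a \<oplus> scale A c (\<Phi> (fixpt c a))"
proof -
  have "\<exists>x. x \<in> carrier A \<and> x = a \<oplus> scale A c (\<Phi> x)"
    using fixed_point_exists[OF assms] by blast
  then have "fixpt c a \<in> carrier A \<and> fixpt c a = a \<oplus> scale A c (\<Phi> (fixpt c a))"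
    unfolding fixpt_def by (rule someI_ex)
  then show "fixpt c a \<in> carrier A" and "fixpt c a = a \<oplus> scale A c (\<Phi> (fixpt c a))" by (rule conjunct1, rule conjunct2)
qed

section \<open>Twisting and untwisting\<close>

lemma W_0_eqI:
  assumes x: "x \<in> carrier A" and "\<And>k. k \<in> I \<Longrightarrow> adj A (s k) \<otimes> x = \<zero>"
  shows "W 0 \<otimes> x = x"
proof -
  have "x = W 0 \<otimes> x \<oplus> scale A 0 (\<Phi> x)"
    using assms by (subst twisted_commutation_iff[symmetric]) auto
  then show ?thesis using x by simp
qed

lemma fixpt_twisted:
  fixes \<nu>
  assumes c: "cmod c < 1" and a: "a \<in> carrier A" "W 0 \<otimes> a = a"
  defines "x \<equiv> fixpt c (a \<otimes> W \<nu>)"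
  shows "W 0 \<otimes> x = a \<otimes> W \<nu>" and "x = W 0 \<otimes> x \<oplus> scale A c (\<Phi> x)"
proof -
  have aW: "a \<otimes> W \<nu> \<in> carrier A" using a by simp
  show W0: "W 0 \<otimes> x = a \<otimes> W \<nu>"
    unfolding x_def
  proof (rule W_0_fixed_point[OF fixpt(1)[OF c aW] aW fixpt(2)[OF c aW]])
    show "W 0 \<otimes> (a \<otimes> W \<nu>) = a \<otimes> W \<nu>" using a by (simp flip: m_assoc)
  qed
  show "x = W 0 \<otimes> x \<oplus> scale A c (\<Phi> x)"
    unfolding W0 unfolding x_def by (rule fixpt(2)[OF c aW])
qed

text \<open>For \<open>\<kappa> = \<bar>c\<bar>\<^sup>2\<close> this is the equation of \<open>adj_mult_fixed_point\<close>, with the scalar \<open>d 1\<close> in place of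
  \<open>x\<^sup>* y\<close>.\<close>

lemma scalar_fixed_point:
  "scale A d \<one> = scale A d (W (1 - \<kappa>)) \<oplus> scale A \<kappa> (\<Phi> (scale A d \<one>))"
proof -
  have "scale A d (W (1 - \<kappa>)) \<oplus> scale A \<kappa> (\<Phi> (scale A d \<one>)) =
      scale A d \<one> \<oplus> (scale A (d * - \<kappa>) (\<Phi> \<one>) \<oplus> scale A (\<kappa> * d) (\<Phi> \<one>))"
    by (simp add: W_def scale_add scale_scale \<Phi>_scale a_assoc)
  also have "\<dots> = scale A d \<one> \<oplus> scale A (d * - \<kappa> + \<kappa> * d) (\<Phi> \<one>)"
    by (simp only: add_scale \<Phi>_closed one_closed)
  finally show ?thesis by simp
qed

text \<open>The scalar \<open>d\<close> stands for a Kronecker symbol. Cancelling \<open>\<bar>c\<bar>\<^sup>2 \<Phi> (d 1)\<close> against \<open>scalar_fixed_point\<close>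
  gives \<open>(W 0 x)\<^sup>* (W 0 y) = d W \<sigma>\<^sup>2\<close>, and the outer factors \<open>W (1 / \<sigma>)\<close> normalise this to \<open>d\<close>.\<close>

lemma orthonormal_untwist:
  assumes c: "cmod c < 1" and \<sigma>: "\<sigma> = complex_of_real (sqrt (1 - (cmod c)\<^sup>2))"
    and x: "x \<in> carrier A" "x = W 0 \<otimes> x \<oplus> scale A c (\<Phi> x)"
    and y: "y \<in> carrier A" "y = W 0 \<otimes> y \<oplus> scale A c (\<Phi> y)"
    and xy: "adj A x \<otimes> y = scale A d \<one>"
  shows "adj A (W 0 \<otimes> x \<otimes> W (1 / \<sigma>)) \<otimes> (W 0 \<otimes> y \<otimes> W (1 / \<sigma>)) = scale A d \<one>"
proof -
  define a b where "a = W 0 \<otimes> x" and "b = W 0 \<otimes> y"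
  have [simp]: "a \<in> carrier A" "b \<in> carrier A" using x(1) y(1) by (simp_all add: a_def b_def)
  have nz: "\<sigma> \<noteq> 0" and \<sigma>\<sigma>: "\<sigma> * \<sigma> = 1 - of_real ((cmod c)\<^sup>2)" and "cnj \<sigma> = \<sigma>"
    by (rule defect_root[OF c \<sigma>])+
  have "adj A a \<otimes> b \<oplus> scale A (of_real ((cmod c)\<^sup>2)) (\<Phi> (scale A d \<one>)) = scale A d \<one>"
    using adj_mult_fixed_point[OF x y] by (simp add: xy a_def b_def)
  also have "\<dots> = scale A d (W (\<sigma> * \<sigma>)) \<oplus> scale A (of_real ((cmod c)\<^sup>2)) (\<Phi> (scale A d \<one>))"
    unfolding \<sigma>\<sigma> by (rule scalar_fixed_point)
  finally have ab: "adj A a \<otimes> b = scale A d (W (\<sigma> * \<sigma>))" by simp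
  have "adj A (a \<otimes> W (1 / \<sigma>)) \<otimes> (b \<otimes> W (1 / \<sigma>)) = W (1 / \<sigma>) \<otimes> (adj A a \<otimes> b) \<otimes> W (1 / \<sigma>)"
    by (simp add: adj_mult adj_W \<open>cnj \<sigma> = \<sigma>\<close> m_assoc)
  also have "\<dots> = scale A d \<one>"
    using nz by (simp add: ab scale_mult_left scale_mult_right W_mult)
  finally show ?thesis by (simp only: a_def b_def)
qed

text \<open>Here \<open>x\<^sup>* y\<close> and \<open>d 1\<close> solve the same equation \<open>z = d W \<sigma>\<^sup>2 + \<bar>c\<bar>\<^sup>2 \<Phi> z\<close>, whose solution is
  unique.\<close>

lemma orthonormal_twist:
  assumes c: "cmod c < 1" and \<sigma>: "\<sigma> = complex_of_real (sqrt (1 - (cmod c)\<^sup>2))"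
    and a: "a \<in> carrier A" "W 0 \<otimes> a = a" and b: "b \<in> carrier A" "W 0 \<otimes> b = b"
    and ab: "adj A a \<otimes> b = scale A d \<one>"
  shows "adj A (fixpt c (a \<otimes> W \<sigma>)) \<otimes> fixpt c (b \<otimes> W \<sigma>) = scale A d \<one>"
proof -
  define x y where "x = fixpt c (a \<otimes> W \<sigma>)" and "y = fixpt c (b \<otimes> W \<sigma>)"
  have \<sigma>\<sigma>: "\<sigma> * \<sigma> = 1 - of_real ((cmod c)\<^sup>2)" and "cnj \<sigma> = \<sigma>"
    by (rule defect_root[OF c \<sigma>])+
  have [simp]: "x \<in> carrier A" "y \<in> carrier A"
    unfolding x_def y_def using a b by (auto intro!: fixpt(1)[OF c])
  note fx = fixpt_twisted[OF c a, of \<sigma>, folded x_def] and fy = fixpt_twisted[OF c b, of \<sigma>, folded y_def]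
  let ?\<kappa> = "complex_of_real ((cmod c)\<^sup>2)"
  have "adj A x \<otimes> y = adj A (a \<otimes> W \<sigma>) \<otimes> (b \<otimes> W \<sigma>) \<oplus> scale A ?\<kappa> (\<Phi> (adj A x \<otimes> y))"
    using adj_mult_fixed_point[of x c y] fx fy by simp
  also have "adj A (a \<otimes> W \<sigma>) \<otimes> (b \<otimes> W \<sigma>) = W \<sigma> \<otimes> (adj A a \<otimes> b) \<otimes> W \<sigma>"
    using a b by (simp add: adj_mult adj_W \<open>cnj \<sigma> = \<sigma>\<close> m_assoc)
  also have "\<dots> = scale A d (W (1 - ?\<kappa>))"
    by (simp add: ab scale_mult_left scale_mult_right W_mult \<sigma>\<sigma>)
  finally have "adj A x \<otimes> y = scale A d (W (1 - ?\<kappa>)) \<oplus> scale A ?\<kappa> (\<Phi> (adj A x \<otimes> y))" .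
  moreover have "cmod ?\<kappa> < 1" using c by (simp add: norm_power power_less_one_iff)
  ultimately show ?thesis
    unfolding x_def[symmetric] y_def[symmetric]
    by (intro fixed_point_unique[OF _ _ _ _ _ scalar_fixed_point]) auto
qed

end

section \<open>Passing between the two presentations\<close>

(* The index set {1..n} is a parameter of the interpretations below and has to keep its form. *)
declare One_nat_def [simp del]

lemma E_family_isometries:
  assumes "unital_cstar_algebra B" and "E_family n m q B s t"
  shows "orthogonal_isometries B {1..n} s"
  using assms unfolding E_family_def
  by (auto intro!: orthogonal_isometries.intro orthogonal_isometries_axioms.intro)

lemma cstar_hom_\<Phi>:
  assumes "orthogonal_isometries A I s" and "orthogonal_isometries B I s'" and h: "h \<in> cstar_hom A B"
    and hs: "\<And>i. i \<in> I \<Longrightarrow> h (s i) = s' i" and x: "x \<in> carrier A"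
  shows "h (orthogonal_isometries.\<Phi> A I s x) = orthogonal_isometries.\<Phi> B I s' (h x)"
proof -
  interpret A: orthogonal_isometries A I s by fact
  interpret B: orthogonal_isometries B I s' by fact
  have "h (A.\<Phi> x) = (\<Oplus>\<^bsub>B\<^esub>j\<in>I. h (s j \<otimes>\<^bsub>A\<^esub> x \<otimes>\<^bsub>A\<^esub> adj A (s j)))"
    unfolding A.\<Phi>_def using x
    by (intro cstar_hom_finsum[OF _ _ h]) (auto intro: A.unital_cstar_algebra_axioms B.unital_cstar_algebra_axioms)
  also have "\<dots> = B.\<Phi> (h x)"
    unfolding B.\<Phi>_def using x
    by (intro B.finsum_cong') (auto simp: cstar_homD[OF h] hs)
  finally show ?thesis .
qed

lemma cstar_hom_W:
  assumes A: "orthogonal_isometries A I s" and B: "orthogonal_isometries B I s'" and h: "h \<in> cstar_hom A B"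
    and hs: "\<And>i. i \<in> I \<Longrightarrow> h (s i) = s' i"
  shows "h (orthogonal_isometries.W A I s \<nu>) = orthogonal_isometries.W B I s' \<nu>"
proof -
  interpret A: orthogonal_isometries A I s by fact
  interpret B: orthogonal_isometries B I s' by fact
  show ?thesis
    unfolding A.W_def B.W_def
    by (simp add: cstar_homD[OF h] cstar_hom_\<Phi>[OF A B h hs])
qed

lemma E_family_twisted:
  assumes "unital_cstar_algebra B" and "E_family n m q B s t" and "r \<in> {1..m}"
  shows "t r = orthogonal_isometries.W B {1..n} s 0 \<otimes>\<^bsub>B\<^esub> t r \<oplus>\<^bsub>B\<^esub>
    scale B q (orthogonal_isometries.\<Phi> B {1..n} s (t r))"
proof -
  interpret B: orthogonal_isometries B "{1..n}" s
    by (rule E_family_isometries[OF assms(1,2)])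
  show ?thesis using assms(2,3) by (subst B.twisted_commutation_iff[symmetric]) (auto simp: E_family_def)
qed

lemma E_family_untwist:
  assumes B: "unital_cstar_algebra B" and fam: "E_family n m q B s t" and q: "cmod q < 1"
    and \<sigma>: "\<sigma> = complex_of_real (sqrt (1 - (cmod q)\<^sup>2))"
  defines "W \<equiv> orthogonal_isometries.W B {1..n} s"
  shows "E_family n m 0 B s (\<lambda>r. W 0 \<otimes>\<^bsub>B\<^esub> t r \<otimes>\<^bsub>B\<^esub> W (1 / \<sigma>))"
proof -
  interpret B: orthogonal_isometries B "{1..n}" s
    by (rule E_family_isometries[OF B fam])
  have t: "t r \<in> carrier B" if "r \<in> {1..m}" for r using fam that by (simp add: E_family_def)
  have "adj B (t r) \<otimes>\<^bsub>B\<^esub> t l = scale B (of_bool (r = l)) \<one>\<^bsub>B\<^esub>" if "r \<in> {1..m}" "l \<in> {1..m}" for r l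
    using fam that by (simp add: E_family_def B.scale_1)
  note B.orthonormal_untwist[OF q \<sigma> t E_family_twisted[OF B fam] t E_family_twisted[OF B fam] this]
  moreover have "adj B (s j) \<otimes>\<^bsub>B\<^esub> (B.W 0 \<otimes>\<^bsub>B\<^esub> t r \<otimes>\<^bsub>B\<^esub> B.W (1 / \<sigma>)) = \<zero>\<^bsub>B\<^esub>"
    if "j \<in> {1..n}" "r \<in> {1..m}" for j r
    using that t by (simp add: B.adj_s_W flip: B.m_assoc)
  ultimately show ?thesis
    using t fam unfolding W_def by (auto simp: E_family_def B.scale_1)
qed

lemma E_family_twist:
  assumes B: "unital_cstar_algebra B" and fam: "E_family n m 0 B s t" and q: "cmod q < 1"
    and \<sigma>: "\<sigma> = complex_of_real (sqrt (1 - (cmod q)\<^sup>2))"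
  defines "W \<equiv> orthogonal_isometries.W B {1..n} s"
  shows "E_family n m q B s (\<lambda>r. orthogonal_isometries.fixpt B {1..n} s q (t r \<otimes>\<^bsub>B\<^esub> W \<sigma>))"
proof -
  interpret B: orthogonal_isometries B "{1..n}" s
    by (rule E_family_isometries[OF B fam])
  have t: "t r \<in> carrier B" if "r \<in> {1..m}" for r using fam that by (simp add: E_family_def)
  have Wt: "B.W 0 \<otimes>\<^bsub>B\<^esub> t r = t r" if "r \<in> {1..m}" for r
    using fam that t by (intro B.W_0_eqI) (auto simp: E_family_def)
  let ?x = "\<lambda>r. B.fixpt q (t r \<otimes>\<^bsub>B\<^esub> B.W \<sigma>)"
  have x: "?x r \<in> carrier B" if "r \<in> {1..m}" for r
    using t[OF that] by (intro B.fixpt(1)[OF q]) auto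
  have tt: "adj B (t r) \<otimes>\<^bsub>B\<^esub> t l = scale B (of_bool (r = l)) \<one>\<^bsub>B\<^esub>" if "r \<in> {1..m}" "l \<in> {1..m}" for r l
    using fam that by (simp add: E_family_def B.scale_1)
  have xx: "adj B (?x r) \<otimes>\<^bsub>B\<^esub> ?x l = scale B (of_bool (r = l)) \<one>\<^bsub>B\<^esub>" if r: "r \<in> {1..m}" and l: "l \<in> {1..m}" for r l
    by (rule B.orthonormal_twist[OF q \<sigma> t[OF r] Wt[OF r] t[OF l] Wt[OF l] tt[OF r l]])
  have "\<forall>j\<in>{1..n}. adj B (s j) \<otimes>\<^bsub>B\<^esub> ?x r = scale B q (?x r \<otimes>\<^bsub>B\<^esub> adj B (s j))"
    if r: "r \<in> {1..m}" for r
    unfolding B.twisted_commutation_iff[OF x[OF r]] by (rule B.fixpt_twisted(2)[OF q t[OF r] Wt[OF r]])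
  then show ?thesis
    unfolding E_family_def W_def using x xx by (auto simp: B.scale_1 B.adj_s_s)
qed

text \<open>The fixed points of a contractive homomorphism form a closed *-subalgebra, and the only one that contains all generators
  is the whole algebra.\<close>

lemma E_cstar_hom_eq_id:
  assumes h: "h \<in> cstar_hom (E_cstar n m q) (E_cstar n m q)"
    and contractive: "\<And>x. x \<in> carrier (E_cstar n m q) \<Longrightarrow> nrm (E_cstar n m q) (h x) \<le> nrm (E_cstar n m q) x"
    and s: "\<And>i. i \<in> {1..n} \<Longrightarrow> h (E_s n m q i) = E_s n m q i"
    and t: "\<And>r. r \<in> {1..m} \<Longrightarrow> h (E_t n m q r) = E_t n m q r"
    and x: "x \<in> carrier (E_cstar n m q)"
  shows "h x = x"
proof -
  let ?E = "E_cstar n m q"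
  interpret E: unital_cstar_algebra ?E by (rule E_cstar_unital_cstar_algebra)
  note hD = cstar_homD[OF h]
  have "{x \<in> carrier ?E. h x = x} = carrier ?E"
  proof (rule E_cstar_generated)
    fix x assume x: "x \<in> carrier ?E"
      and approx: "\<And>e. e > 0 \<Longrightarrow> \<exists>d\<in>{x \<in> carrier ?E. h x = x}. nrm ?E (x \<ominus>\<^bsub>?E\<^esub> d) < e"
    have "nrm ?E (h x \<ominus>\<^bsub>?E\<^esub> x) \<le> 0 + e" if e: "e > 0" for e
    proof -
      obtain d where d: "d \<in> carrier ?E" "h d = d" "nrm ?E (x \<ominus>\<^bsub>?E\<^esub> d) < e / 2"
        using approx[of "e / 2"] e by auto
      have "h (x \<ominus>\<^bsub>?E\<^esub> d) = h x \<ominus>\<^bsub>?E\<^esub> d"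
        using x d(1,2) by (simp add: a_minus_def hD flip: E.scale_uminus)
      then have "nrm ?E (h x \<ominus>\<^bsub>?E\<^esub> d) \<le> nrm ?E (x \<ominus>\<^bsub>?E\<^esub> d)"
        using contractive[of "x \<ominus>\<^bsub>?E\<^esub> d"] x d(1) by simp
      then show ?thesis
        using E.nrm_minus_triangle[of "h x" d x] E.nrm_minus_commute[of d x] x d hD(1)[OF x] by simp
    qed
    then have "nrm ?E (h x \<ominus>\<^bsub>?E\<^esub> x) \<le> 0" by (rule field_le_epsilon)
    then have "h x = x"
      using x hD(1)[OF x] E.nrm_nonneg[of "h x \<ominus>\<^bsub>?E\<^esub> x"] by (simp add: E.nrm_eq_0 E.minus_eq_zero)
    with x show "x \<in> {x \<in> carrier ?E. h x = x}" by simp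
  qed (use E_cstar_family[of n m q] in \<open>auto simp: hD s t E_family_def\<close>)
  with x show ?thesis by blast
qed

theorem theorem2p12:
  fixes n m :: nat and q :: complex
  assumes "n \<ge> 2" and "m \<ge> 2" and "cmod q < 1"
  shows "cstar_isomorphic (E_cstar n m q) (E_cstar n m 0)"
proof -
  note q = \<open>cmod q < 1\<close>
  define \<sigma> where \<sigma>: "\<sigma> = complex_of_real (sqrt (1 - (cmod q)\<^sup>2))"
  have \<sigma>0: "\<sigma> \<noteq> 0" by (rule defect_root(1)[OF q \<sigma>])
  let ?E = "E_cstar n m q" and ?F = "E_cstar n m 0"
  note cstarE = E_cstar_unital_cstar_algebra[of n m q] and cstarF = E_cstar_unital_cstar_algebra[of n m 0]
  note famE = E_cstar_family[of n m q] and famF = E_cstar_family[of n m 0]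
  note isoE = E_family_isometries[OF cstarE famE] and isoF = E_family_isometries[OF cstarF famF]
  interpret E: orthogonal_isometries ?E "{1..n}" "E_s n m q" by (rule isoE)
  interpret F: orthogonal_isometries ?F "{1..n}" "E_s n m 0" by (rule isoF)
  have tE: "E_t n m q r \<in> carrier ?E" and tF: "E_t n m 0 r \<in> carrier ?F" if "r \<in> {1..m}" for r
    using famE famF that by (simp_all add: E_family_def)
  define u where "u r = E.W 0 \<otimes>\<^bsub>?E\<^esub> E_t n m q r \<otimes>\<^bsub>?E\<^esub> E.W (1 / \<sigma>)" for r
  define v where "v r = F.fixpt q (E_t n m 0 r \<otimes>\<^bsub>?F\<^esub> F.W \<sigma>)" for r
  obtain f where f: "f \<in> cstar_hom ?E ?F"
    and fs: "\<And>i. i \<in> {1..n} \<Longrightarrow> f (E_s n m q i) = E_s n m 0 i"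
    and ft: "\<And>r. r \<in> {1..m} \<Longrightarrow> f (E_t n m q r) = v r"
    and f_le: "\<And>x. x \<in> carrier ?E \<Longrightarrow> nrm ?F (f x) \<le> nrm ?E x"
    using E_cstar_universal[OF cstarF E_family_twist[OF cstarF famF q \<sigma>]] unfolding v_def by blast
  obtain g where g: "g \<in> cstar_hom ?F ?E"
    and gs: "\<And>i. i \<in> {1..n} \<Longrightarrow> g (E_s n m 0 i) = E_s n m q i"
    and gt: "\<And>r. r \<in> {1..m} \<Longrightarrow> g (E_t n m 0 r) = u r"
    and g_le: "\<And>x. x \<in> carrier ?F \<Longrightarrow> nrm ?E (g x) \<le> nrm ?F x"
    using E_cstar_universal[OF cstarE E_family_untwist[OF cstarE famE q \<sigma>]] unfolding u_def by blast
  note fD = cstar_homD[OF f] and gD = cstar_homD[OF g]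
  have f_W: "f (E.W \<nu>) = F.W \<nu>" and g_W: "g (F.W \<nu>) = E.W \<nu>" for \<nu>
    using cstar_hom_W[OF isoE isoF f] cstar_hom_W[OF isoF isoE g] fs gs by blast+
  have g_\<Phi>: "g (F.\<Phi> x) = E.\<Phi> (g x)" if "x \<in> carrier ?F" for x
    using cstar_hom_\<Phi>[OF isoF isoE g _ that] gs by blast
  have v: "v r \<in> carrier ?F" "v r = E_t n m 0 r \<otimes>\<^bsub>?F\<^esub> F.W \<sigma> \<oplus>\<^bsub>?F\<^esub> scale ?F q (F.\<Phi> (v r))"
      "F.W 0 \<otimes>\<^bsub>?F\<^esub> v r = E_t n m 0 r \<otimes>\<^bsub>?F\<^esub> F.W \<sigma>" if r: "r \<in> {1..m}" for r
  proof -
    have aW: "E_t n m 0 r \<otimes>\<^bsub>?F\<^esub> F.W \<sigma> \<in> carrier ?F" using tF[OF r] by simp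
    have "F.W 0 \<otimes>\<^bsub>?F\<^esub> E_t n m 0 r = E_t n m 0 r"
      using famF r tF[OF r] by (intro F.W_0_eqI) (auto simp: E_family_def)
    from F.fixpt[OF q aW] F.fixpt_twisted(1)[OF q tF[OF r] this, of \<sigma>]
    show "v r \<in> carrier ?F" "v r = E_t n m 0 r \<otimes>\<^bsub>?F\<^esub> F.W \<sigma> \<oplus>\<^bsub>?F\<^esub> scale ?F q (F.\<Phi> (v r))"
      "F.W 0 \<otimes>\<^bsub>?F\<^esub> v r = E_t n m 0 r \<otimes>\<^bsub>?F\<^esub> F.W \<sigma>"
      unfolding v_def .
  qed
  \<comment> \<open>The image under \<open>g\<close> of the equation for \<open>v r\<close> is the one that characterises \<open>t\<^sub>r\<close>.\<close>
  have gf: "(g \<circ> f) x = x" if "x \<in> carrier ?E" for x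
  proof (rule E_cstar_hom_eq_id[OF cstar_hom_compose[OF f g]])
    fix r assume r: "r \<in> {1..m}"
    have "g (v r) = g (E_t n m 0 r \<otimes>\<^bsub>?F\<^esub> F.W \<sigma> \<oplus>\<^bsub>?F\<^esub> scale ?F q (F.\<Phi> (v r)))"
      by (rule arg_cong[OF v(2)[OF r]])
    also have "\<dots> = u r \<otimes>\<^bsub>?E\<^esub> E.W \<sigma> \<oplus>\<^bsub>?E\<^esub> scale ?E q (E.\<Phi> (g (v r)))"
      using r v(1) tF by (simp add: gD gt g_W g_\<Phi>)
    also have "u r \<otimes>\<^bsub>?E\<^esub> E.W \<sigma> = E.W 0 \<otimes>\<^bsub>?E\<^esub> E_t n m q r"
      using tE[OF r] \<sigma>0 by (simp add: u_def E.m_assoc E.W_mult)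
    finally have "g (v r) = E.W 0 \<otimes>\<^bsub>?E\<^esub> E_t n m q r \<oplus>\<^bsub>?E\<^esub> scale ?E q (E.\<Phi> (g (v r)))" .
    then have "g (v r) = E_t n m q r"
      using tE[OF r] v(1)[OF r]
      by (intro E.fixed_point_unique[OF q _ _ _ _ E_family_twisted[OF cstarE famE r]]) (auto simp: gD(1))
    then show "(g \<circ> f) (E_t n m q r) = E_t n m q r" by (simp add: ft[OF r])
  next
    show "nrm ?E ((g \<circ> f) x) \<le> nrm ?E x" if "x \<in> carrier ?E" for x
      using order_trans[OF g_le f_le] fD(1) that by simp
  qed (simp_all add: that fs gs)
  have fg: "(f \<circ> g) x = x" if "x \<in> carrier ?F" for x
  proof (rule E_cstar_hom_eq_id[OF cstar_hom_compose[OF g f]])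
    fix r assume r: "r \<in> {1..m}"
    have "f (u r) = F.W 0 \<otimes>\<^bsub>?F\<^esub> v r \<otimes>\<^bsub>?F\<^esub> F.W (1 / \<sigma>)"
      using r tE by (simp add: u_def fD ft f_W)
    also have "\<dots> = E_t n m 0 r"
      using tF[OF r] \<sigma>0 by (simp add: v(3)[OF r] F.m_assoc F.W_mult)
    finally show "(f \<circ> g) (E_t n m 0 r) = E_t n m 0 r" by (simp add: gt[OF r])
  next
    show "nrm ?F ((f \<circ> g) x) \<le> nrm ?F x" if "x \<in> carrier ?F" for x
      using order_trans[OF f_le g_le] gD(1) that by simp
  qed (simp_all add: that fs gs)
  show ?thesis using gf fg by (intro cstar_isomorphicI[OF f g]) simp_all
qed

end
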